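(* Let $m\ge 2$ be an integer, let $1\le q<\infty$, and let $\boldsymbol\alpha=(\boldsymbol\alpha_0,\dots,\boldsymbol\alpha_m)$ with $\boldsymbol\alpha_r>0$ for all $r$. Then there is a constant $\kappa_{\boldsymbol\alpha}$, depending only on $\boldsymbol\alpha$ (in particular not on $n$), such that for every integer $n\ge 1$ the Hausdorff distance between the multiball of periodic first-order splines and the periodic Sobolev multiball satisfies $$d_{\mathcal H}\big(\mathcal L^{m,q}_{\sharp,n}(\boldsymbol\alpha),\,W^{m,q}_\sharp(\boldsymbol\alpha)\big)\le \frac{\kappa_{\boldsymbol\alpha}}{n^2}.$$
   Context: Fix $d\ge1$ and a norm $\|\cdot\|$ on $\mathbb R^d$. A discretized curve is a family $\mathbf p=(\mathbf p_0,\dots,\mathbf p_{n-1})\in\mathbb R^{n\times d}$ of points of $\mathbb R^d$, with indices read modulo $n$: $\mathbf p_i=\mathbf p_{i \bmod n}$ for $i\in\mathbb Z$. The renormalized norm is $\|\mathbf p\|_{\ell^q}=\big(\frac1n\sum_{i=0}^{n-1}\|\mathbf p_i\|^q\big)^{1/q}$. The discrete derivative of order $r$ is $(\Delta^{\star r}\star\mathbf p)_i=\sum_{j=0}^r(-1)^j\binom rj\mathbf p_{i-j}$, i.e. the $r$-fold iterate of $\mathbf p\mapsto(\mathbf p_i-\mathbf p_{i-1})_i$. Periodic Sobolev multiball: $W^{m,q}_\sharp(\boldsymbol\alpha)$ is the set of $1$-periodic functions $f:[0,1]\to\mathbb R^d$ in $L^1$ whose (periodic, weak) derivatives satisfy $\|f^{(r)}\|_{L^q([0,1])}\le\boldsymbol\alpha_r$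 for all $0\le r\le m$. Discrete periodic multiball: $\mathcal P^{m,q}_{\sharp,n}(\boldsymbol\alpha)=\{\mathbf p\in\mathbb R^{n\times d}: n^r\|\Delta^{\star r}\star\mathbf p\|_{\ell^q}\le\boldsymbol\alpha_r \text{ for all } 0\le r\le m\}$. First-order spline (linear interpolation): $s^1(\mathbf p):[0,1]\to\mathbb R^d$, $s^1(\mathbf p)(t)=\mathbf p_{\lfloor nt\rfloor}+\{nt\}\,(\mathbf p_{\lceil nt\rceil}-\mathbf p_{\lfloor nt\rfloor})$, where $\{nt\}=nt-\lfloor nt\rfloor$, and $\mathcal L^{m,q}_{\sharp,n}(\boldsymbol\alpha)=\{s^1(\mathbf p):\mathbf p\in\mathcal P^{m,q}_{\sharp,n}(\boldsymbol\alpha)\}$. Distance between curves: $d(f,g)=\int_0^1\|f(t)-g(t)\|\,dt$. Hausdorff distance between two sets of curves: $d_{\mathcal H}(A,B)=\sup_{f\in A}\inf_{g\in B}d(f,g)+\sup_{g\in B}\inf_{f\in A}d(f,g)$. *)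

theory Defs
  imports "HOL-Analysis.Analysis"
begin

text \<open>The fixed norm on \<open>\<real>\<^sup>d\<close> is arbitrary, so it is a function \<open>N\<close> and not the type class
  norm of \<^typ>\<open>real ^ 'd\<close>, which is the Euclidean one. Nonnegativity of \<open>N\<close> follows from the
  three axioms.\<close>

definition is_norm :: "(real ^ 'd \<Rightarrow> real) \<Rightarrow> bool" where
  "is_norm N \<longleftrightarrow>
     (\<forall>x. N x = 0 \<longleftrightarrow> x = 0) \<and>
     (\<forall>c x. N (c *\<^sub>R x) = \<bar>c\<bar> * N x) \<and>
     (\<forall>x y. N (x + y) \<le> N x + N y)"

text \<open>A family of \<open>n\<close> points with indices read modulo \<open>n\<close> is an \<open>n\<close>-periodic sequence
  over the integers.\<close>

definition discretized_curve :: "nat \<Rightarrow> (int \<Rightarrow> real ^ 'd) \<Rightarrow> bool" where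
  "discretized_curve n p \<longleftrightarrow> (\<forall>i. p i = p (i mod int n))"

definition lq_norm :: "(real ^ 'd \<Rightarrow> real) \<Rightarrow> real \<Rightarrow> nat \<Rightarrow> (int \<Rightarrow> real ^ 'd) \<Rightarrow> real" where
  "lq_norm N q n p = (1 / real n * (\<Sum>i<n. N (p (int i)) powr q)) powr (1 / q)"

definition discrete_deriv :: "nat \<Rightarrow> (int \<Rightarrow> real ^ 'd) \<Rightarrow> int \<Rightarrow> real ^ 'd" where
  "discrete_deriv r p i = (\<Sum>j\<le>r. ((- 1) ^ j * real (r choose j)) *\<^sub>R p (i - int j))"

definition discrete_multiball ::
  "(real ^ 'd \<Rightarrow> real) \<Rightarrow> nat \<Rightarrow> real \<Rightarrow> nat \<Rightarrow> (nat \<Rightarrow> real) \<Rightarrow> (int \<Rightarrow> real ^ 'd) set" where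
  "discrete_multiball N m q n \<alpha> =
     {p. discretized_curve n p \<and>
         (\<forall>r\<le>m. real n ^ r * lq_norm N q n (discrete_deriv r p) \<le> \<alpha> r)}"

text \<open>Curves are functions on the whole real line: the formula for the spline, applied to an
  \<open>n\<close>-periodic sequence, is \<open>1\<close>-periodic.\<close>

definition spline1 :: "nat \<Rightarrow> (int \<Rightarrow> real ^ 'd) \<Rightarrow> real \<Rightarrow> real ^ 'd" where
  "spline1 n p t =
     p \<lfloor>real n * t\<rfloor> + frac (real n * t) *\<^sub>R (p \<lceil>real n * t\<rceil> - p \<lfloor>real n * t\<rfloor>)"

definition spline_multiball ::
  "(real ^ 'd \<Rightarrow> real) \<Rightarrow> nat \<Rightarrow> real \<Rightarrow> nat \<Rightarrow> (nat \<Rightarrow> real) \<Rightarrow> (real \<Rightarrow> real ^ 'd) set" where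
  "spline_multiball N m q n \<alpha> = spline1 n ` discrete_multiball N m q n \<alpha>"

definition periodic1 :: "(real \<Rightarrow> 'a) \<Rightarrow> bool" where
  "periodic1 f \<longleftrightarrow> (\<forall>t. f (t + 1) = f t)"

definition periodic_test_function :: "(real \<Rightarrow> real) \<Rightarrow> bool" where
  "periodic_test_function \<phi> \<longleftrightarrow>
     periodic1 \<phi> \<and> (\<forall>k t. (deriv ^^ k) \<phi> field_differentiable at t)"

text \<open>\<open>g\<close> is the periodic weak derivative of order \<open>r\<close> of \<open>f\<close>. The test functions are all smooth
  periodic functions, not only those with compact support in the open interval, so that jumps of
  \<open>f\<close> and its derivatives across the period boundary are excluded. Only the values of \<open>g\<close> on
  the unit interval matter, up to null sets.\<close>

definition has_periodic_weak_deriv ::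
  "nat \<Rightarrow> (real \<Rightarrow> real ^ 'd) \<Rightarrow> (real \<Rightarrow> real ^ 'd) \<Rightarrow> bool" where
  "has_periodic_weak_deriv r f g \<longleftrightarrow>
     integrable (lebesgue_on {0..1}) f \<and> integrable (lebesgue_on {0..1}) g \<and>
     (\<forall>\<phi>. periodic_test_function \<phi> \<longrightarrow>
        (\<integral>t. (deriv ^^ r) \<phi> t *\<^sub>R f t \<partial>lebesgue_on {0..1}) =
        (- 1) ^ r *\<^sub>R (\<integral>t. \<phi> t *\<^sub>R g t \<partial>lebesgue_on {0..1}))"

text \<open>Finiteness of the \<open>L\<^sup>q\<close> norm is required separately because the integral of a
  non-integrable function is \<open>0\<close>.\<close>

definition Lq_norm_le ::
  "(real ^ 'd \<Rightarrow> real) \<Rightarrow> real \<Rightarrow> (real \<Rightarrow> real ^ 'd) \<Rightarrow> real \<Rightarrow> bool" where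
  "Lq_norm_le N q g a \<longleftrightarrow>
     integrable (lebesgue_on {0..1}) (\<lambda>t. N (g t) powr q) \<and>
     (\<integral>t. N (g t) powr q \<partial>lebesgue_on {0..1}) powr (1 / q) \<le> a"

definition sobolev_multiball ::
  "(real ^ 'd \<Rightarrow> real) \<Rightarrow> nat \<Rightarrow> real \<Rightarrow> (nat \<Rightarrow> real) \<Rightarrow> (real \<Rightarrow> real ^ 'd) set" where
  "sobolev_multiball N m q \<alpha> =
     {f. periodic1 f \<and> integrable (lebesgue_on {0..1}) f \<and>
         (\<forall>r\<le>m. \<exists>g. has_periodic_weak_deriv r f g \<and> Lq_norm_le N q g (\<alpha> r))}"

text \<open>Distances take values in \<^typ>\<open>ennreal\<close>, a complete lattice, so that no boundedness or
  nonemptiness condition is needed for the suprema and infima to be meaningful.\<close>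

definition curve_dist ::
  "(real ^ 'd \<Rightarrow> real) \<Rightarrow> (real \<Rightarrow> real ^ 'd) \<Rightarrow> (real \<Rightarrow> real ^ 'd) \<Rightarrow> ennreal" where
  "curve_dist N f g = (\<integral>\<^sup>+t. ennreal (N (f t - g t)) \<partial>lebesgue_on {0..1})"

definition hausdorff_dist ::
  "(real ^ 'd \<Rightarrow> real) \<Rightarrow> (real \<Rightarrow> real ^ 'd) set \<Rightarrow> (real \<Rightarrow> real ^ 'd) set \<Rightarrow> ennreal" where
  "hausdorff_dist N A B =
     (SUP f\<in>A. INF g\<in>B. curve_dist N f g) + (SUP g\<in>B. INF f\<in>A. curve_dist N f g)"

end

theory Submission
  imports Defs
begin

text \<open>
  Let \<open>w = 1/n\<close>, let \<open>T\<close> be the average over a centred window of width \<open>w\<close> and let \<open>D\<close> be the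
  centred difference quotient of step \<open>w\<close>, so that \<open>T F' = D F\<close>. Both commute, and \<open>T\<close> is a
  contraction of every \<open>L\<^sup>q\<close> by Jensen's inequality. For the norm \<open>N\<close>, a supporting functional
  reduces each pointwise estimate to a scalar one.

  From splines to Sobolev functions: if \<open>S\<close> is the step function taking the value \<open>p\<^sub>i\<close> around
      \<open>i/n\<close>,
  then \<open>T S\<close> is the spline and \<open>T\<^sup>m S\<close> has the weak derivatives \<open>T\<^sup>m\<^sup>-\<^sup>r D\<^sup>r S\<close>, where \<open>D\<^sup>r S\<close> is
  a step function with values \<open>n\<^sup>r \<Delta>\<^sup>r p\<close>; hence \<open>T\<^sup>m S\<close> lies in the Sobolev multiball. Each further
  application of \<open>T\<close> to the spline moves it by at most the mean of \<open>N (\<Delta>\<^sup>2 p)\<close>, that is \<open>\<alpha>\<^sub>2/n\<^sup>2\<close>.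

  From Sobolev functions to splines: convolution with a trigonometric approximate identity keeps \<open>f\<close>
  in the multiball and moves it arbitrarily little in \<open>L\<^sup>1\<close>, which is enough because the Hausdorff
  distance only involves infima; so \<open>f\<close> may be taken smooth. Sampling \<open>T f\<close> at the points \<open>i/n\<close>
  gives an admissible \<open>p\<close>, because \<open>n\<^sup>r \<Delta>\<^sup>r p\<close> is a sample of \<open>T\<^sup>r\<^sup>+\<^sup>1 f\<^sup>(\<^sup>r\<^sup>)\<close>
      and the windows of the
  outermost \<open>T\<close> tile the period. The first-order Taylor terms cancel in the interpolation error, and
  the remainder is bounded by \<open>9/(2n\<^sup>2)\<close> times an average of \<open>N (f'')\<close>.
\<close>

section \<open>Periodic functions on the unit interval\<close>

abbreviation circ :: "real measure" where "circ \<equiv> lebesgue_on {0..1}"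

interpretation circ: finite_measure circ
  by (rule finite_measure_lebesgue_on) simp

interpretation circ2: pair_sigma_finite circ circ ..

lemma id_measurable_circ [measurable]: "(\<lambda>x. x) \<in> borel_measurable circ"
  using id_borel_measurable_lebesgue_on[of "{0..1::real}"] by (simp add: id_def)

lemma integrable_circ_bounded:
  fixes f :: "real \<Rightarrow> 'a::euclidean_space"
  assumes "f \<in> borel_measurable circ" "\<And>x. norm (f x) \<le> B"
  shows "integrable circ f"
  using assms by (intro circ.integrable_const_bound[of _ B]) auto

text \<open>Borel rather than Lebesgue measurability is required so that composition with shifts and
  with two-variable maps stays measurable. Boundedness makes integrability over a period
  automatic.\<close>

definition bpm :: "(real \<Rightarrow> 'a::euclidean_space) \<Rightarrow> bool" where
  "bpm u \<longleftrightarrow> u \<in> borel_measurable borel \<and> bounded (range u) \<and> periodic1 u"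

lemma bpm_measurable: "bpm u \<Longrightarrow> u \<in> borel_measurable borel"
  and bpm_periodic: "bpm u \<Longrightarrow> u (t + 1) = u t"
  by (auto simp: bpm_def periodic1_def)

lemma bpm_bound: assumes "bpm u" obtains B where "\<And>t. norm (u t) \<le> B" "B > 0"
  using assms unfolding bpm_def bounded_pos by auto

lemma periodic1_of_int:
  assumes "periodic1 u" shows "u (t + of_int i) = u t"
proof (induction i rule: int_induct[where k=0])
  case (step1 i)
  then show ?case using assms by (simp add: periodic1_def flip: add.assoc)
next
  case (step2 i)
  have "u (t + of_int (i - 1) + 1) = u (t + of_int (i - 1))" using assms unfolding periodic1_def
    by blast
  then show ?case using step2 by simp
qed simp

lemma bpm_periodic_int: "bpm u \<Longrightarrow> u (t + of_int i) = u t"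
  by (simp add: bpm_def periodic1_of_int)

lemma bpm_shift: assumes "bpm u" shows "bpm (\<lambda>t. u (t + a))"
proof -
  note [measurable] = bpm_measurable[OF assms]
  have "range (\<lambda>t. u (t + a)) \<subseteq> range u" by auto
  then show ?thesis
    using assms bounded_subset bpm_periodic[OF assms]
    by (auto simp: bpm_def periodic1_def algebra_simps) (metis add.commute add.left_commute)
qed

lemma bpm_scaleR: assumes "bpm (u :: real \<Rightarrow> real)" "bpm v" shows "bpm (\<lambda>t. u t *\<^sub>R v t)"
proof -
  from bpm_bound[OF assms(1)] bpm_bound[OF assms(2)] obtain A B where
    *: "\<And>t. norm (u t) \<le> A" "A > 0" "\<And>t. norm (v t) \<le> B" "B > 0" by metis
  have "norm (u t *\<^sub>R v t) \<le> A * B" for t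
    using *(1,3)[of t] *(2,4) by (auto intro!: mult_mono)
  then show ?thesis using assms by (auto simp: bpm_def periodic1_def bounded_iff)
qed

text \<open>Boundedness survives because the closure of the range of \<open>u\<close> is compact and
  has a compact image.\<close>

lemma bpm_continuous_compose:
  fixes g :: "'a::euclidean_space \<Rightarrow> 'b::euclidean_space"
  assumes "bpm u" "continuous_on UNIV g" shows "bpm (\<lambda>t. g (u t))"
proof -
  note [measurable] = bpm_measurable[OF assms(1)] borel_measurable_continuous_onI[OF assms(2)]
  have "compact (g ` closure (range u))"
    using assms by (intro compact_continuous_image) (auto simp: bpm_def intro: continuous_on_subset)
  then have "bounded (range (\<lambda>t. g (u t)))"
    by (rule bounded_subset[OF compact_imp_bounded]) (use closure_subset[of "range u"] in blast)
  then show ?thesis using assms(1) by (auto simp: bpm_def periodic1_def)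
qed

text \<open>Every value is already taken at \<open>frac t\<close>, hence on a compact
  interval.\<close>

lemma bpm_continuous:
  assumes "continuous_on UNIV u" "\<And>t. u (t + 1) = u t" shows "bpm u"
proof -
  have "u t \<in> u ` {0..1}" for t
  proof -
    from periodic1_of_int[of u "frac t" "\<lfloor>t\<rfloor>"] assms(2) have "u t = u (frac t)"
      by (simp add: frac_def periodic1_def)
    then show ?thesis by (auto intro!: image_eqI[of _ _ "frac t"] frac_lt_1 less_imp_le)
  qed
  then have "range u \<subseteq> u ` {0..1}" by auto
  moreover have "compact (u ` {0..1})"
    using assms(1) by (intro compact_continuous_image) (auto intro: continuous_on_subset)
  ultimately have "bounded (range u)" using bounded_subset compact_imp_bounded by metis
  then show ?thesis using assms
    by (auto simp: bpm_def periodic1_def intro!: borel_measurable_continuous_onI)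
qed

lemma integrable_bpm_compose:
  assumes "bpm u" "h \<in> borel_measurable circ" shows "integrable circ (\<lambda>t. u (h t))"
proof -
  from bpm_bound[OF assms(1)] obtain B where B: "\<And>t. norm (u t) \<le> B" by metis
  note [measurable] = bpm_measurable[OF assms(1)] assms(2)
  show ?thesis by (rule integrable_circ_bounded[OF _ B]) measurable
qed

lemma integrable_bpm: "bpm u \<Longrightarrow> integrable circ u"
  using integrable_bpm_compose[of u "\<lambda>x. x"] by simp

lemma bpm_integrable_on: assumes "bpm u" shows "u integrable_on {a..b}"
proof -
  from bpm_bound[OF assms(1)] obtain B where B: "\<And>t. norm (u t) \<le> B" by metis
  have "u \<in> borel_measurable (lebesgue_on {a..b})"
    using bpm_measurable[OF assms]
      by (simp add: borel_measurable_if_D measurable_completion measurable_restrict_space1)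
  then have "integrable (lebesgue_on {a..b}) u"
    using B by (intro finite_measure.integrable_const_bound[of _ _ B]
        finite_measure_lebesgue_on) auto
  then show ?thesis by (rule integrable_on_lebesgue_on) simp
qed

lemma circ_integral_eq: "bpm u \<Longrightarrow> (\<integral>t. u (h t) \<partial>circ) = integral {0..1} (\<lambda>t. u (h t))"
  if "h \<in> borel_measurable circ"
  by (rule lebesgue_integral_eq_integral) (auto intro!: integrable_bpm_compose that)

text \<open>Periodicity reduces the shift to \<open>frac a\<close>. The part of the shifted period
  that sticks out beyond 1 is then moved back to the start of the unit interval.\<close>

lemma integral_unit_shift:
  assumes "bpm u" shows "(\<integral>t. u (t + a) \<partial>circ) = (\<integral>t. u t \<partial>circ)"
proof -
  let ?b = "frac a"
  have b: "0 \<le> ?b" "?b \<le> 1" by (auto intro: less_imp_le frac_lt_1)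
  have "(\<integral>t. u (t + a) \<partial>circ) = (\<integral>t. u (t + ?b) \<partial>circ)"
    using bpm_periodic_int[OF assms, of "_ + ?b" "\<lfloor>a\<rfloor>"] by (simp add: frac_def)
  also have "\<dots> = integral {0..1} (\<lambda>t. u (t + ?b))"
    by (rule circ_integral_eq[OF _ assms]) measurable
  also have "\<dots> = integral {?b..1+?b} u"
    using integral_shift_real_ivl[of ?b ?b "1+?b" u] by simp
  also have "\<dots> = integral {?b..1} u + integral {1..1+?b} u"
    using b by (intro Henstock_Kurzweil_Integration.integral_combine[symmetric]
        bpm_integrable_on assms) auto
  also have "integral {1..1+?b} u = integral {0..?b} u"
    using integral_shift_real_ivl[of 1 1 "1+?b" u] bpm_periodic[OF assms] by simp
  also have "integral {?b..1} u + integral {0..?b} u = integral {0..1} u"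
    using b by (subst add.commute,
        intro Henstock_Kurzweil_Integration.integral_combine bpm_integrable_on assms) auto
  also have "\<dots> = (\<integral>t. u t \<partial>circ)"
    by (rule circ_integral_eq[OF _ assms, symmetric]) measurable
  finally show ?thesis .
qed

lemma integral_unit_reflect:
  assumes "bpm u" shows "(\<integral>t. u (a - t) \<partial>circ) = (\<integral>t. u t \<partial>circ)"
proof -
  have "(\<integral>t. u (a - t) \<partial>circ) = integral {0..1} (\<lambda>t. u (a - t))"
    by (rule circ_integral_eq[OF _ assms]) measurable
  also have "\<dots> = integral {-1..0} (\<lambda>t. u (t + a))"
    using Henstock_Kurzweil_Integration.integral_reflect_real[of 0 "-1" "\<lambda>t. u (t + a)"]
    by (simp add: add.commute[of _ a])
  also have "\<dots> = integral {0..1} (\<lambda>t. u (t + a))"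
    using integral_shift_real_ivl[of "-1" "-1" 0 "\<lambda>t. u (t + a)"]
      bpm_periodic[OF assms, of "_ + a - 1"] by (simp add: algebra_simps)
  also have "\<dots> = (\<integral>t. u (t + a) \<partial>circ)"
    by (rule circ_integral_eq[OF _ assms, symmetric]) measurable
  finally show ?thesis using integral_unit_shift[OF assms] by simp
qed

text \<open>Each of the \<open>n\<close> tiles of the period is rescaled to the unit interval. This
  is the link between integrals and sums over the nodes, for step functions as well as for sampled
  averages.\<close>

lemma integral_unit_tiles:
  assumes "bpm u" "n \<ge> 1"
  shows "(\<integral>t. u t \<partial>circ) = (1 / real n) *\<^sub>R (\<Sum>i<n. \<integral>s. u ((real i + s) / real n) \<partial>circ)"
proof -
  have n: "real n > 0" using assms by simp
  have tile: "(\<integral>s. u ((real i + s) / real n) \<partial>circ)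
      = real n *\<^sub>R integral {real i / n .. real (Suc i) / n} u" for i
  proof -
    have "(u has_integral integral {real i / n .. real (Suc i) / n} u) (cbox (real i / n) (real
        (Suc i) / n))"
      using bpm_integrable_on[OF assms(1)] by (auto simp: has_integral_iff)
    moreover have "(\<lambda>x. x * real n - real i) ` {real i / n .. real (Suc i) / n} = {0..1}"
      using n image_affinity_atLeastAtMost_diff[of "real n" "real i" "real i / n" "real (Suc i) /
          n"]
      by (simp add: mult.commute divide_simps)
    ultimately
    have "((\<lambda>s. u ((real i + s) / n)) has_integral (real n *\<^sub>R integral {real i / n .. real (Suc
        i) / n} u)) {0..1}"
      using has_integral_affinity[of u _ "real i / n" "real (Suc i) / n" "1 / n" "real i / n"] n
      by (simp add: field_simps)
    moreover have "(\<integral>s. u ((real i + s) / real n) \<partial>circ)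
        = integral {0..1} (\<lambda>s. u ((real i + s) / real n))"
      by (rule circ_integral_eq[OF _ assms(1)]) measurable
    ultimately show ?thesis by (simp add: has_integral_iff)
  qed
  have "integral {0..real k / n} u = (\<Sum>i<k. integral {real i / n .. real (Suc i) / n} u)" for k
  proof (induction k)
    case (Suc k)
    have "integral {0..real k / n} u + integral {real k / n .. real (Suc k) / n} u
        = integral {0..real (Suc k) / n} u"
      using n by (intro Henstock_Kurzweil_Integration.integral_combine bpm_integrable_on assms)
          (auto simp: divide_right_mono)
    then show ?case using Suc by simp
  qed simp
  from this[of n] n have "integral {0..1} u = (\<Sum>i<n. integral {real i / n .. real (Suc i) / n} u)"
    by simp
  moreover have "(\<integral>t. u t \<partial>circ) = integral {0..1} u"
    by (rule circ_integral_eq[OF _ assms(1)]) measurable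
  ultimately show ?thesis using n by (simp add: tile scaleR_sum_right)
qed

section \<open>Norms and Jensen's inequality\<close>

lemma is_norm_scaleR: "is_norm N \<Longrightarrow> N (c *\<^sub>R x) = \<bar>c\<bar> * N x"
  and is_norm_triangle: "is_norm N \<Longrightarrow> N (x + y) \<le> N x + N y"
  and is_norm_zero: "is_norm N \<Longrightarrow> N 0 = 0"
  by (auto simp: is_norm_def)

lemma is_norm_minus: "is_norm N \<Longrightarrow> N (- x) = N x"
  using is_norm_scaleR[of N "-1" x] by simp

lemma is_norm_nonneg: "is_norm N \<Longrightarrow> 0 \<le> N x"
  using is_norm_triangle[of N x "-x"] by (simp add: is_norm_minus is_norm_zero)

lemma is_norm_diff_triangle: "is_norm N \<Longrightarrow> N (x - z) \<le> N (x - y) + N (y - z)"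
  using is_norm_triangle[of N "x - y" "y - z"] by simp

lemma is_norm_diff_commute: "is_norm N \<Longrightarrow> N (x - y) = N (y - x)"
  using is_norm_minus[of N "x - y"] by simp

text \<open>Expansion in the standard basis compares \<open>N\<close> with the Euclidean norm.
  Continuity, measurability and integrability of \<open>N\<close> all rest on this one-sided
  bound.\<close>

lemma is_norm_bound:
  assumes "is_norm N" obtains C where "C > 0" "\<And>x. N x \<le> C * norm x"
proof
  let ?C = "1 + (\<Sum>b\<in>Basis. N b)"
  show "?C > 0" using is_norm_nonneg[OF assms] by (simp add: add_pos_nonneg sum_nonneg)
  fix x
  have sum: "N (sum f S) \<le> (\<Sum>i\<in>S. N (f i))" if "finite S" for f :: "real^'a \<Rightarrow> real^'a" and S
    using that
  proof induction
    case (insert i S) then show ?case using is_norm_triangle[OF assms, of "f i" "sum f S"] by simp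
  qed (simp add: is_norm_zero[OF assms])
  have "N x = N (\<Sum>b\<in>Basis. (x \<bullet> b) *\<^sub>R b)" by (simp add: euclidean_representation)
  also have "\<dots> \<le> (\<Sum>b\<in>Basis. \<bar>x \<bullet> b\<bar> * N b)"
    using sum[of Basis "\<lambda>b. (x \<bullet> b) *\<^sub>R b"] by (simp add: is_norm_scaleR[OF assms])
  also have "\<dots> \<le> (\<Sum>b\<in>Basis. norm x * N b)"
    by (intro sum_mono mult_right_mono is_norm_nonneg assms Basis_le_norm)
  also have "\<dots> \<le> ?C * norm x" by (simp add: sum_distrib_left[symmetric]
      algebra_simps flip: sum_distrib_right)
  finally show "N x \<le> ?C * norm x" .
qed

lemma continuous_on_is_norm: assumes "is_norm N" shows "continuous_on S N"
proof -
  obtain C where C: "C > 0" "\<And>x. N x \<le> C * norm x" using is_norm_bound[OF assms] by blast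
  have "\<bar>N x - N y\<bar> \<le> C * dist x y" for x y
    using is_norm_triangle[OF assms, of "x - y" y] is_norm_triangle[OF assms, of "y - x" x]
      C(2)[of "x - y"] C(2)[of "y - x"] by (simp add: dist_norm norm_minus_commute)
  then show ?thesis
    using C(1) by (intro lipschitz_on_continuous_on[of C] lipschitz_onI) (auto simp: dist_real_def)
qed

lemma is_norm_measurable [measurable (raw)]:
  assumes "is_norm N" "g \<in> borel_measurable M" shows "(\<lambda>x. N (g x)) \<in> borel_measurable M"
  using measurable_compose[OF assms(2) borel_measurable_continuous_onI[OF continuous_on_is_norm[OF
      assms(1)]]] .

lemma integrable_is_norm:
  assumes "is_norm N" "integrable M g" shows "integrable M (\<lambda>x. N (g x))"
proof -
  obtain C where C: "C > 0" "\<And>x. N x \<le> C * norm x" using is_norm_bound[OF assms(1)] by blast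
  have "integrable M (\<lambda>x. C * norm (g x))" using assms(2) by simp
  then show ?thesis
    by (rule Bochner_Integration.integrable_bound) (use assms C is_norm_nonneg[OF assms(1)]
        in \<open>auto intro: is_norm_measurable abs_ge_self[THEN order_trans]\<close>)
qed

text \<open>Finite-dimensional Hahn-Banach: a hyperplane separates \<open>x\<close> from the open
  \<open>N\<close>-ball of radius \<open>N x\<close>, and its normal is rescaled to take the value
  \<open>N x\<close> at \<open>x\<close>.\<close>

lemma supporting_functional:
  assumes N: "is_norm N"
  obtains a where "\<And>y. a \<bullet> y \<le> N y" "a \<bullet> x = N x"
proof (cases "x = 0")
  case True
  then show ?thesis using is_norm_nonneg[OF N] is_norm_zero[OF N] by (intro that[of 0]) auto
next
  case False
  then have pos: "N x > 0" using N is_norm_nonneg[OF N, of x] unfolding is_norm_def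
    by (metis less_eq_real_def)
  have "convex {y. N y < N x}"
  proof (rule convexI)
    fix y z :: "real^'a" and u v :: real
    assume *: "y \<in> {y. N y < N x}" "z \<in> {y. N y < N x}" "0 \<le> u" "0 \<le> v" "u + v = 1"
    have "N (u *\<^sub>R y + v *\<^sub>R z) \<le> u * N y + v * N z"
      using is_norm_triangle[OF N, of "u *\<^sub>R y" "v *\<^sub>R z"] * by (simp add: is_norm_scaleR[OF N])
    also have "\<dots> < N x" using * by (intro convex_bound_lt) auto
    finally show "u *\<^sub>R y + v *\<^sub>R z \<in> {y. N y < N x}" by simp
  qed
  then obtain a b where a: "a \<noteq> 0" "\<And>y. N y < N x \<Longrightarrow> a \<bullet> y \<le> b" "b \<le> a \<bullet> x"
    using separating_hyperplane_sets[of "{y. N y < N x}" "{x}"] pos is_norm_zero[OF N] by force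
  \<comment> \<open>Homogeneity upgrades the separation to a linear inequality: \<open>y\<close> is
    scaled by \<open>s\<close> to lie strictly inside the ball. The slack \<open>d\<close> ensures
    strictness, covers \<open>N y = 0\<close>, and costs at most \<open>e\<close>.\<close>
  have le: "a \<bullet> y * N x \<le> (a \<bullet> x) * N y" for y
  proof (rule field_le_epsilon)
    fix e :: real assume "e > 0"
    define d where "d = e / (\<bar>a \<bullet> x\<bar> + 1)"
    have d: "d > 0" and "d * \<bar>a \<bullet> x\<bar> \<le> e" using \<open>e > 0\<close> by (auto simp: d_def field_simps)
    define s where "s = N x / (N y + d)"
    have s: "s > 0" using pos d is_norm_nonneg[OF N, of y] by (simp add: s_def add_nonneg_pos)
    have "N (s *\<^sub>R y) < N x"
      using pos d is_norm_nonneg[OF N, of y] s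
        by (simp add: is_norm_scaleR[OF N]) (simp add: s_def field_simps add_nonneg_pos)
    from a(2)[OF this] a(3) have "s * (a \<bullet> y) \<le> a \<bullet> x" by simp
    then have "N x * (a \<bullet> y) \<le> (a \<bullet> x) * (N y + d)"
      using d is_norm_nonneg[OF N, of y] by (simp add: s_def field_simps add_nonneg_pos)
    also have "(a \<bullet> x) * d \<le> e" using \<open>d * \<bar>a \<bullet> x\<bar> \<le> e\<close> d
      by (smt (verit) mult.commute mult_left_mono)
    then have "(a \<bullet> x) * (N y + d) \<le> (a \<bullet> x) * N y + e" by (simp add: algebra_simps)
    finally show "a \<bullet> y * N x \<le> (a \<bullet> x) * N y + e" by (simp add: mult.commute)
  qed
  \<comment> \<open>The inequality just proved is tested at \<open>y = a\<close>.\<close>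
  have "a \<bullet> x > 0"
  proof -
    have "0 < (a \<bullet> a) * N x" using a(1) pos by simp
    also have "\<dots> \<le> (a \<bullet> x) * N a" by (rule le)
    finally show ?thesis using is_norm_nonneg[OF N, of a] by (simp add: zero_less_mult_iff)
  qed
  then show ?thesis using le pos
    by (intro that[of "(N x / (a \<bullet> x)) *\<^sub>R a"]) (auto simp: field_simps)
qed

text \<open>Convexity of the power function. The tangent inequality is applied on the open
  half-line, so zero arguments are treated apart; for \<open>c = 0\<close> the left side vanishes
  even when \<open>q = 1\<close>, because \<open>0 powr 0 = 0\<close>.\<close>

lemma powr_above_tangent:
  fixes u c q :: real
  assumes "u \<ge> 0" "c \<ge> 0" "q \<ge> 1"
  shows "c powr q + q * c powr (q - 1) * (u - c) \<le> u powr q"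
proof (cases "c = 0 \<or> u = 0")
  case True
  then show ?thesis
  proof
    assume "u = 0"
    moreover have "c powr q = c powr (q - 1) * c" using assms
      by (cases "c = 0") (auto simp: powr_diff)
    ultimately show ?thesis using assms mult_right_mono[of 1 q "c powr (q - 1) * c"]
      by (auto simp: algebra_simps)
  qed (use assms in auto)
next
  case False
  then have "c > 0" "u > 0" using assms by auto
  have "u powr q - c powr q \<ge> (q * c powr (q - 1)) * (u - c)"
  proof (rule convex_on_imp_above_tangent[where A = "{0<..}" and f = "\<lambda>x. x powr q"])
    show "convex_on {0<..} (\<lambda>x. x powr q)"
      using assms by (intro powr_convex)
  qed (use \<open>c > 0\<close> \<open>u > 0\<close> in \<open>auto intro!: derivative_eq_intros simp: interior_open\<close>)
  then show ?thesis by simp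
qed

text \<open>The tangent inequality at the mean \<open>c\<close> is multiplied by \<open>k\<close>
  and integrated; the linear term drops out because \<open>k\<close> has total mass 1.\<close>

lemma jensen_powr:
  fixes v k :: "'a \<Rightarrow> real"
  assumes "q \<ge> 1" and v: "\<And>x. v x \<ge> 0" and k: "\<And>x. k x \<ge> 0" "integrable M k" "(\<integral>x. k x \<partial>M) = 1"
    and kv: "integrable M (\<lambda>x. k x * v x)" and kvq: "integrable M (\<lambda>x. k x * v x powr q)"
  shows "(\<integral>x. k x * v x \<partial>M) powr q \<le> (\<integral>x. k x * v x powr q \<partial>M)"
proof -
  define c where "c = (\<integral>x. k x * v x \<partial>M)"
  have c: "c \<ge> 0" unfolding c_def by (intro integral_nonneg_AE) (auto simp: v k)
  let ?t = "\<lambda>x. (c powr q - q * c powr (q - 1) * c) * k x + q * c powr (q - 1) * (k x * v x)"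
  have "(\<integral>x. ?t x \<partial>M) = (c powr q - q * c powr (q - 1) * c) + q * c powr (q - 1) * c"
    using k kv by (subst Bochner_Integration.integral_add) (auto simp: c_def)
  moreover have "(\<integral>x. ?t x \<partial>M) \<le> (\<integral>x. k x * v x powr q \<partial>M)"
  proof (intro integral_mono kvq)
    fix x
    have "k x * (c powr q + q * c powr (q - 1) * (v x - c)) \<le> k x * v x powr q"
      using powr_above_tangent[OF v c assms(1)] k by (intro mult_left_mono) auto
    then show "?t x \<le> k x * v x powr q" by (simp add: algebra_simps)
  qed (use k kv in auto)
  ultimately show ?thesis by (simp add: c_def)
qed

text \<open>The functional supporting \<open>N\<close> at the integral commutes with integration and
  is dominated by \<open>N\<close>.\<close>

lemma is_norm_integral_le:
  assumes N: "is_norm N" and g: "integrable M g"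
  shows "N (\<integral>x. g x \<partial>M) \<le> (\<integral>x. N (g x) \<partial>M)"
proof -
  obtain a where a: "\<And>y. a \<bullet> y \<le> N y" "a \<bullet> (\<integral>x. g x \<partial>M) = N (\<integral>x. g x \<partial>M)"
    using supporting_functional[OF N] by metis
  have "N (\<integral>x. g x \<partial>M) = (\<integral>x. a \<bullet> g x \<partial>M)" using g a by simp
  also have "\<dots> \<le> (\<integral>x. N (g x) \<partial>M)"
    using g a by (intro integral_mono integrable_is_norm[OF N]) auto
  finally show ?thesis .
qed

text \<open>The weight \<open>k\<close> serves two purposes later: constant for window averages, a
  translated kernel for convolutions.\<close>

lemma jensen_is_norm:
  assumes N: "is_norm N" and "q \<ge> 1"
    and k: "\<And>x. k x \<ge> (0::real)" "integrable M k" "(\<integral>x. k x \<partial>M) = 1"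
    and kg: "integrable M (\<lambda>x. k x *\<^sub>R g x)" and kgq: "integrable M (\<lambda>x. k x * N (g x) powr q)"
  shows "N (\<integral>x. k x *\<^sub>R g x \<partial>M) powr q \<le> (\<integral>x. k x * N (g x) powr q \<partial>M)"
proof -
  have "N (\<integral>x. k x *\<^sub>R g x \<partial>M) \<le> (\<integral>x. k x * N (g x) \<partial>M)"
    using is_norm_integral_le[OF N kg] k by (simp add: is_norm_scaleR[OF N])
  then have "N (\<integral>x. k x *\<^sub>R g x \<partial>M) powr q \<le> (\<integral>x. k x * N (g x) \<partial>M) powr q"
    using assms is_norm_nonneg[OF N] by (intro powr_mono2) auto
  also have "\<dots> \<le> (\<integral>x. k x * N (g x) powr q \<partial>M)"
    using integrable_is_norm[OF N kg] k assms is_norm_nonneg[OF N]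
    by (intro jensen_powr) (auto simp: is_norm_scaleR[OF N])
  finally show ?thesis .
qed

lemma continuous_on_is_norm_powr: "is_norm N \<Longrightarrow> q \<ge> 1 \<Longrightarrow> continuous_on S (\<lambda>x. N x powr q)"
  by (intro continuous_on_powr' continuous_on_is_norm continuous_intros) (auto simp: is_norm_nonneg)

lemma bpm_is_norm: "is_norm N \<Longrightarrow> bpm u \<Longrightarrow> bpm (\<lambda>t. N (u t))"
  using bpm_continuous_compose continuous_on_is_norm by blast

lemma bpm_is_norm_powr: "is_norm N \<Longrightarrow> q \<ge> 1 \<Longrightarrow> bpm u \<Longrightarrow> bpm (\<lambda>t. N (u t) powr q)"
  using bpm_continuous_compose[of u "\<lambda>x. N x powr q"] continuous_on_is_norm_powr by blast

section \<open>Averages and difference quotients\<close>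

text \<open>The window is parametrized by the unit interval, so that Fubini always runs over the
  same product space and negative widths make sense. For nonzero \<open>w\<close> this is the mean
  over the window of width \<open>\<bar>w\<bar>\<close> centred at \<open>t\<close>.\<close>

definition avg :: "real \<Rightarrow> (real \<Rightarrow> 'a::euclidean_space) \<Rightarrow> real \<Rightarrow> 'a" where
  "avg w u t = (\<integral>s. u (t + w * (s - 1 / 2)) \<partial>circ)"

definition diffq :: "real \<Rightarrow> (real \<Rightarrow> 'a::euclidean_space) \<Rightarrow> real \<Rightarrow> 'a" where
  "diffq w u t = (1 / w) *\<^sub>R (u (t + w / 2) - u (t - w / 2))"

lemma measurable_pair_circ [measurable]:
  "fst \<in> borel_measurable (circ \<Otimes>\<^sub>M circ)" "snd \<in> borel_measurable (circ \<Otimes>\<^sub>M circ)"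
  "snd \<in> borel_measurable (borel \<Otimes>\<^sub>M circ)"
  by (auto intro: measurable_compose[OF measurable_fst] measurable_compose[OF measurable_snd])

lemma integrable_circ2_bounded:
  fixes f :: "real \<times> real \<Rightarrow> 'a::euclidean_space"
  assumes "f \<in> borel_measurable (circ \<Otimes>\<^sub>M circ)" "\<And>x. norm (f x) \<le> B"
  shows "integrable (circ \<Otimes>\<^sub>M circ) f"
proof -
  have "finite_measure (circ \<Otimes>\<^sub>M circ)" by (rule finite_measure_pair_measure) unfold_locales
  then show ?thesis using assms by (intro finite_measure.integrable_const_bound[of _ _ B]) auto
qed

lemma integrable_avg: "bpm u \<Longrightarrow> integrable circ (\<lambda>s. u (t + w * (s - 1 / 2)))"
  by (rule integrable_bpm_compose) measurable

lemma bpm_avg: assumes "bpm u" shows "bpm (avg w u)"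
proof -
  note [measurable] = bpm_measurable[OF assms]
  obtain B where B: "\<And>t. norm (u t) \<le> B" using bpm_bound[OF assms] by metis
  have "(\<lambda>t. \<integral>s. u (t + w * (s - 1 / 2)) \<partial>circ) \<in> borel_measurable borel" by measurable
  moreover have "norm (avg w u t) \<le> B" for t
  proof -
    have "norm (avg w u t) \<le> (\<integral>s. norm (u (t + w * (s - 1 / 2))) \<partial>circ)"
      unfolding avg_def by (rule integral_norm_bound)
    also have "\<dots> \<le> (\<integral>s. B \<partial>circ)"
      using integrable_avg[OF assms] B by (intro integral_mono) auto
    finally show ?thesis by (simp add: measure_restrict_space)
  qed
  moreover have "avg w u (t + 1) = avg w u t" for t
    using bpm_periodic[OF assms, of "t + w * (_ - 1 / 2)"] by (simp add: avg_def algebra_simps)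
  ultimately show ?thesis by (auto simp: bpm_def avg_def[abs_def] bounded_iff periodic1_def)
qed

text \<open>After Fubini the inner integral runs over a shifted period and no longer depends on the
  shift.\<close>

lemma integral_unit_avg: assumes "bpm u" shows "(\<integral>t. avg w u t \<partial>circ) = (\<integral>t. u t \<partial>circ)"
proof -
  note [measurable] = bpm_measurable[OF assms]
  obtain B where B: "\<And>t. norm (u t) \<le> B" using bpm_bound[OF assms] by metis
  have "(\<integral>t. avg w u t \<partial>circ) = (\<integral>s. \<integral>t. u (t + w * (s - 1 / 2)) \<partial>circ \<partial>circ)"
    unfolding avg_def by (rule circ2.Fubini_integral,
        rule integrable_circ2_bounded[of _ B]) (auto simp: B split: prod.split)
  then show ?thesis by (simp add: integral_unit_shift[OF assms] measure_restrict_space)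
qed

lemma avg_diff: "bpm u \<Longrightarrow> bpm v \<Longrightarrow> avg w (\<lambda>t. u t - v t) t = avg w u t - avg w v t"
  by (simp add: avg_def integrable_avg)

lemma avg_scaleR: "avg w (\<lambda>t. c *\<^sub>R u t) t = c *\<^sub>R avg w u t"
  by (simp add: avg_def)

lemma avg_shift: "avg w (\<lambda>t. u (t + a)) t = avg w u (t + a)"
  by (simp add: avg_def algebra_simps)

lemma bpm_diff: assumes "bpm u" "bpm v" shows "bpm (\<lambda>t. u t - v t)"
  using assms bounded_minus_comp[of u UNIV v] by (auto simp: bpm_def periodic1_def)

lemma bpm_diffq: assumes "bpm u" shows "bpm (diffq w u)"
proof -
  have "bpm (\<lambda>t. (1 / w) *\<^sub>R (u (t + w / 2) - u (t + (- (w / 2)))))"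
    by (intro bpm_continuous_compose[where g
        = "\<lambda>x. (1 / w) *\<^sub>R x"] bpm_diff bpm_shift assms continuous_intros)
  then show ?thesis by (simp add: diffq_def[abs_def])
qed

lemma avg_diffq: assumes "bpm u" shows "avg w (diffq w u) = diffq w (avg w u)"
proof
  fix t
  have "avg w (diffq w u) t = avg w (\<lambda>t. (1 / w) *\<^sub>R (u (t + w / 2) - u (t + - (w / 2)))) t"
    by (simp add: diffq_def[abs_def])
  also have "\<dots> = (1 / w) *\<^sub>R (avg w u (t + w / 2) - avg w u (t + - (w / 2)))"
    by (simp only: avg_scaleR avg_diff bpm_shift assms avg_shift)
  finally show "avg w (diffq w u) t = diffq w (avg w u) t" by (simp add: diffq_def)
qed

lemma jensen_avg:
  assumes N: "is_norm N" "q \<ge> 1" and u: "bpm u"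
  shows "N (avg w u t) powr q \<le> avg w (\<lambda>t. N (u t) powr q) t"
  using jensen_is_norm[OF N, of "\<lambda>_. 1" circ "\<lambda>s. u (t + w * (s - 1 / 2))"]
    integrable_avg[OF u] integrable_avg[OF bpm_is_norm_powr[OF N u]]
  by (simp add: avg_def measure_restrict_space)

lemma integral_avg_powr_le:
  assumes N: "is_norm N" "q \<ge> 1" and u: "bpm u"
  shows "(\<integral>t. N (avg w u t) powr q \<partial>circ) \<le> (\<integral>t. N (u t) powr q \<partial>circ)"
proof -
  have "(\<integral>t. N (avg w u t) powr q \<partial>circ) \<le> (\<integral>t. avg w (\<lambda>t. N (u t) powr q) t \<partial>circ)"
    by (intro integral_mono integrable_bpm bpm_is_norm_powr N u bpm_avg jensen_avg)
  then show ?thesis by (simp add: integral_unit_avg bpm_is_norm_powr N u)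
qed

text \<open>Jensen with constant weight on a space of mass 1. It turns the \<open>q\<close>-norm
  bound on second derivatives into the bound on their mean that controls the distance.\<close>

lemma integral_powr_mono:
  assumes N: "is_norm N" "q \<ge> 1" and u: "bpm u"
  shows "(\<integral>t. N (u t) \<partial>circ) powr q \<le> (\<integral>t. N (u t) powr q \<partial>circ)"
  using jensen_powr[of q "\<lambda>t. N (u t)" "\<lambda>_. 1" circ] is_norm_nonneg[OF N(1)] N
    integrable_bpm[OF bpm_is_norm[OF N(1) u]] integrable_bpm[OF bpm_is_norm_powr[OF N u]]
  by (simp add: measure_restrict_space)

lemma avg_deriv:
  assumes "\<And>t. (F has_vector_derivative F' t) (at t)" "bpm F'" "w \<noteq> 0"
  shows "avg w F' = diffq w F"
proof
  fix t
  have "((\<lambda>s. w *\<^sub>R F' (t + w * (s - 1 / 2))) has_integral (F (t + w * (1 - 1 / 2)) - F (t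
      + w * (0 - 1 / 2)))) {0..1}"
  proof (rule fundamental_theorem_of_calculus)
    fix s :: real
    have "((\<lambda>s. t + w * (s - 1 / 2)) has_vector_derivative w) (at s within {0..1})"
      by (auto intro!: derivative_eq_intros simp:
          has_real_derivative_iff_has_vector_derivative[symmetric])
    from vector_diff_chain_within[OF this has_vector_derivative_at_within[OF assms(1)]]
    show "((\<lambda>s. F (t + w * (s - 1 / 2))) has_vector_derivative w *\<^sub>R F' (t
        + w * (s - 1 / 2))) (at s within {0..1})"
      by (simp add: o_def)
  qed simp
  from has_integral_cmul[OF this, of "1 / w"]
  have "integral {0..1} (\<lambda>s. F' (t + w * (s - 1 / 2))) = diffq w F t"
    using assms(3) by (simp add: diffq_def has_integral_iff)
  moreover have "avg w F' t = integral {0..1} (\<lambda>s. F' (t + w * (s - 1 / 2)))"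
    unfolding avg_def by (rule circ_integral_eq[OF _ assms(2)]) measurable
  ultimately show "avg w F' t = diffq w F t" by simp
qed

text \<open>Integration by parts that asks no regularity of \<open>u\<close>: the average is moved
  onto \<open>\<phi>'\<close>, becomes a difference quotient of \<open>\<phi>\<close> there, and
  that quotient is moved back onto \<open>u\<close>. The minus sign arises because the centred
  difference is antisymmetric.\<close>

lemma integral_deriv_avg:
  fixes \<phi> :: "real \<Rightarrow> real"
  assumes "\<And>t. (\<phi> has_vector_derivative \<phi>' t) (at t)" and \<phi>: "bpm \<phi>" and \<phi>': "bpm \<phi>'"
      and u: "bpm u" and w: "w \<noteq> 0"
  shows "(\<integral>t. \<phi>' t *\<^sub>R avg w u t \<partial>circ) = - (\<integral>t. \<phi> t *\<^sub>R diffq w u t \<partial>circ)"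
proof -
  note [measurable] = bpm_measurable[OF \<phi>'] bpm_measurable[OF u]
  obtain A B where AB: "\<And>t. norm (u t) \<le> B" "\<And>t. norm (\<phi>' t) \<le> A" "A > 0"
    using bpm_bound[OF u] bpm_bound[OF \<phi>'] by metis
  have bd: "norm (\<phi>' a *\<^sub>R u b) \<le> A * B" for a b using AB(1)[of b] AB(2)[of a] AB(3)
    by (auto intro!: mult_mono)
  have "(\<integral>t. \<phi>' t *\<^sub>R avg w u t \<partial>circ) = (\<integral>t. \<integral>s. \<phi>' t *\<^sub>R u (t + w * (s - 1 / 2)) \<partial>circ \<partial>circ)"
    using integrable_avg[OF u] by (simp add: avg_def)
  also have "\<dots> = (\<integral>s. \<integral>t. \<phi>' t *\<^sub>R u (t + w * (s - 1 / 2)) \<partial>circ \<partial>circ)"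
    by (rule circ2.Fubini_integral,
        rule integrable_circ2_bounded[of _ "A * B"]) (use bd in \<open>auto split: prod.split\<close>)
  \<comment> \<open>Translating the period by the offset \<open>w * (s - 1 / 2)\<close> frees
    \<open>u\<close> from \<open>s\<close>.\<close>
  also have "\<dots> = (\<integral>s. \<integral>t. \<phi>' (t - w * (s - 1 / 2)) *\<^sub>R u t \<partial>circ \<partial>circ)"
  proof (rule Bochner_Integration.integral_cong[OF refl])
    fix s
    show "(\<integral>t. \<phi>' t *\<^sub>R u (t + w * (s - 1 / 2)) \<partial>circ)
        = (\<integral>t. \<phi>' (t - w * (s - 1 / 2)) *\<^sub>R u t \<partial>circ)"
      using integral_unit_shift[OF bpm_scaleR[OF bpm_shift[OF \<phi>'] u],
          of "w * (s - 1 / 2)" "- (w * (s - 1 / 2))"] by simp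
  qed
  also have "\<dots> = (\<integral>t. \<integral>s. \<phi>' (t - w * (s - 1 / 2)) *\<^sub>R u t \<partial>circ \<partial>circ)"
    by (rule circ2.Fubini_integral,
        rule integrable_circ2_bounded[of _ "A * B"]) (use bd in \<open>auto split: prod.split\<close>)
  also have "\<dots> = (\<integral>t. diffq w \<phi> t *\<^sub>R u t \<partial>circ)"
  proof (rule Bochner_Integration.integral_cong[OF refl])
    fix t
    \<comment> \<open>The reversed offset amounts to width \<open>- w\<close>, and the centred
      difference quotient is even in its step.\<close>
    have "(\<integral>s. \<phi>' (t - w * (s - 1 / 2)) \<partial>circ) = avg (- w) \<phi>' t" by (simp add: avg_def)
    also have "\<dots> = diffq w \<phi> t" using avg_deriv[OF assms(1) \<phi>', of "- w"] w
      by (simp add: diffq_def divide_simps)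
    finally show "(\<integral>s. \<phi>' (t - w * (s - 1 / 2)) *\<^sub>R u t \<partial>circ) = diffq w \<phi> t *\<^sub>R u t"
      using integrable_bpm_compose[OF \<phi>', of "\<lambda>s. t - w * (s - 1 / 2)"] by simp
  qed
  also have "\<dots> = - (\<integral>t. \<phi> t *\<^sub>R diffq w u t \<partial>circ)"
  proof -
    note i = integrable_bpm[OF bpm_scaleR[OF bpm_shift[OF \<phi>] bpm_shift[OF u]]]
    have sh: "(\<integral>t. \<phi> (t + a) *\<^sub>R u t \<partial>circ) = (\<integral>t. \<phi> t *\<^sub>R u (t - a) \<partial>circ)" for a
      using integral_unit_shift[OF bpm_scaleR[OF bpm_shift[OF \<phi>] u], of "- a" a] by simp
    have e: "diffq w \<phi> t *\<^sub>R u t = (1 / w) *\<^sub>R (\<phi> (t + w / 2) *\<^sub>R u t - \<phi> (t - w / 2) *\<^sub>R u t)"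
      "\<phi> t *\<^sub>R diffq w u t = (1 / w) *\<^sub>R (\<phi> t *\<^sub>R u (t + w / 2) - \<phi> t *\<^sub>R u (t - w / 2))" for t
      by (simp_all add: diffq_def algebra_simps)
    have "(\<integral>t. diffq w \<phi> t *\<^sub>R u t \<partial>circ)
        = (1 / w) *\<^sub>R ((\<integral>t. \<phi> (t + w / 2) *\<^sub>R u t \<partial>circ) - (\<integral>t. \<phi> (t - w / 2) *\<^sub>R u t \<partial>circ))"
      unfolding e using i[of "w / 2" 0] i[of "- (w / 2)" 0]
      by (subst integral_scaleR_right, subst Bochner_Integration.integral_diff) simp_all
    moreover have "(\<integral>t. \<phi> t *\<^sub>R diffq w u t \<partial>circ)
        = (1 / w) *\<^sub>R ((\<integral>t. \<phi> t *\<^sub>R u (t + w / 2) \<partial>circ) - (\<integral>t. \<phi> t *\<^sub>R u (t - w / 2) \<partial>circ))"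
      unfolding e using i[of 0 "w / 2"] i[of 0 "- (w / 2)"]
      by (subst integral_scaleR_right, subst Bochner_Integration.integral_diff) simp_all
    ultimately show ?thesis
      using sh[of "w / 2"] sh[of "- (w / 2)"] by (simp add: scaleR_diff_right)
  qed
  finally show ?thesis .
qed

section \<open>Sobolev functions near splines\<close>

lemma discrete_deriv_0 [simp]: "discrete_deriv 0 p = p"
  by (simp add: discrete_deriv_def fun_eq_iff)

text \<open>Pascal's rule for the binomial coefficients, after splitting off the term with index
  0.\<close>

lemma discrete_deriv_Suc:
  "discrete_deriv (Suc r) p i = discrete_deriv r p i - discrete_deriv r p (i - 1)"
proof -
  let ?x = "\<lambda>j. p (i - int j)"
  have "discrete_deriv (Suc r) p i
      = ?x 0 + (\<Sum>j\<le>r. ((- 1) ^ Suc j * real (Suc r choose Suc j)) *\<^sub>R ?x (Suc j))"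
    unfolding discrete_deriv_def by (subst sum.atMost_Suc_shift) simp
  also have "\<dots> = (?x 0 + (\<Sum>j\<le>r. ((- 1) ^ Suc j * real (r choose Suc j)) *\<^sub>R ?x (Suc j)))
      - (\<Sum>j\<le>r. ((- 1) ^ j * real (r choose j)) *\<^sub>R ?x (Suc j))"
  proof -
    have "(\<Sum>j\<le>r. ((- 1) ^ Suc j * real (Suc r choose Suc j)) *\<^sub>R ?x (Suc j))
      = (\<Sum>j\<le>r. ((- 1) ^ Suc j * real (r choose Suc j)) *\<^sub>R ?x (Suc j) - ((- 1) ^ j * real (r
          choose j)) *\<^sub>R ?x (Suc j))"
      by (intro sum.cong) (simp_all add: algebra_simps)
    then show ?thesis by (simp only: sum_subtractf add_diff_eq)
  qed
  also have "?x 0 + (\<Sum>j\<le>r. ((- 1) ^ Suc j * real (r choose Suc j)) *\<^sub>R ?x (Suc j))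
      = (\<Sum>j\<le>Suc r. ((- 1) ^ j * real (r choose j)) *\<^sub>R ?x j)"
    by (subst sum.atMost_Suc_shift) simp
  also have "\<dots> = discrete_deriv r p i" by (simp add: discrete_deriv_def)
  also have "(\<Sum>j\<le>r. ((- 1) ^ j * real (r choose j)) *\<^sub>R ?x (Suc j)) = discrete_deriv r p (i - 1)"
    by (simp add: discrete_deriv_def algebra_simps)
  finally show ?thesis .
qed

lemma discretized_curve_add:
  assumes "discretized_curve n p" shows "p (i + int n) = p i"
  using assms unfolding discretized_curve_def by (metis mod_add_self2)

lemma discretized_curve_discrete_deriv:
  assumes "discretized_curve n p" shows "discretized_curve n (discrete_deriv r p)"
proof -
  have "p (i - int j) = p (i mod int n - int j)" for i j
    using assms unfolding discretized_curve_def by (metis mod_diff_left_eq)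
  then show ?thesis by (simp add: discretized_curve_def discrete_deriv_def)
qed

text \<open>The offset \<open>1 / 2\<close> centres each plateau at its node, so that averaging over
  one mesh width interpolates linearly between the nodes.\<close>

definition step :: "nat \<Rightarrow> (int \<Rightarrow> 'a) \<Rightarrow> real \<Rightarrow> 'a" where
  "step n p t = p \<lfloor>real n * t + 1 / 2\<rfloor>"

text \<open>The offset \<open>c\<close> is free because every difference quotient of a step function
  moves it by a half. Boundedness comes from the finitely many residues modulo
  \<open>n\<close>.\<close>

lemma bpm_floor:
  fixes p :: "int \<Rightarrow> real ^ 'd"
  assumes p: "discretized_curve n p" and n: "n \<ge> 1"
  shows "bpm (\<lambda>t. p \<lfloor>real n * t + c\<rfloor>)"
proof -
  have "p i \<in> p ` {0..<int n}" for i
    using p n unfolding discretized_curve_def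
      by (metis atLeastLessThan_iff imageI of_nat_0_less_iff pos_mod_bound pos_mod_sign
          zero_less_one order_less_le_trans)
  then have "bounded (range (\<lambda>t. p \<lfloor>real n * t + c\<rfloor>))"
    by (intro finite_imp_bounded[OF finite_subset[where B = "p ` {0..<int n}"]]) auto
  moreover have "(\<lambda>t. p \<lfloor>real n * t + c\<rfloor>) \<in> borel_measurable borel"
    by (rule measurable_compose[of _ _ "count_space UNIV"]) auto
  moreover have "p \<lfloor>real n * (t + 1) + c\<rfloor> = p \<lfloor>real n * t + c\<rfloor>" for t
  proof -
    have "real n * (t + 1) + c = (real n * t + c) + of_int (int n)" by (simp add: algebra_simps)
    then show ?thesis using discretized_curve_add[OF p] by (metis floor_add_int)
  qed
  ultimately show ?thesis by (simp add: bpm_def periodic1_def)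
qed

lemma bpm_step: "discretized_curve n p \<Longrightarrow> n \<ge> 1 \<Longrightarrow> bpm (step n p)"
  unfolding step_def[abs_def] by (rule bpm_floor)

text \<open>Translation by \<open>c / n\<close> removes the offset; on each tile the floor is then
  constant up to a null set.\<close>

lemma integral_floor:
  fixes p :: "int \<Rightarrow> real ^ 'd"
  assumes p: "discretized_curve n p" and n: "n \<ge> 1" and g: "continuous_on UNIV g"
  shows "(\<integral>t. (g (p \<lfloor>real n * t + c\<rfloor>) :: real) \<partial>circ) = 1 / real n * (\<Sum>i<n. g (p (int i)))"
proof -
  have b: "bpm (\<lambda>t. g (p \<lfloor>real n * t + c\<rfloor>))" for c
    by (rule bpm_continuous_compose[OF bpm_floor[OF p n] g])
  have "(\<integral>t. g (p \<lfloor>real n * t + c\<rfloor>) \<partial>circ) = (\<integral>t. g (p \<lfloor>real n * t\<rfloor>) \<partial>circ)"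
    using integral_unit_shift[OF b[of 0], of "c / n"] n by (simp add: algebra_simps)
  also have "\<dots> = 1 / real n * (\<Sum>i<n. \<integral>s. g (p \<lfloor>real n * ((real i + s) / real n)\<rfloor>) \<partial>circ)"
    using integral_unit_tiles[OF b[of 0] n] by simp
  also have "(\<lambda>i. \<integral>s. g (p \<lfloor>real n * ((real i + s) / real n)\<rfloor>) \<partial>circ) = (\<lambda>i. g (p (int i)))"
  proof
    fix i
    \<comment> \<open>At \<open>s = 1\<close> the floor has already jumped to
      \<open>i + 1\<close>.\<close>
    have "AE s in circ. s \<noteq> 1"
      by (rule AE_I[of _ _ "{1}"]) (auto simp: emeasure_restrict_space sets_restrict_space_iff)
    then have "AE s in circ. g (p \<lfloor>real n * ((real i + s) / real n)\<rfloor>) = g (p (int i))"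
      using AE_space
    proof eventually_elim
      case (elim s)
      then have "\<lfloor>real n * ((real i + s) / real n)\<rfloor> = int i" using n by (auto simp: floor_eq_iff)
      then show ?case by simp
    qed
    then have "(\<integral>s. g (p \<lfloor>real n * ((real i + s) / real n)\<rfloor>) \<partial>circ) = (\<integral>s. g (p (int i)) \<partial>circ)"
      using integrable_bpm_compose[OF b[of 0], of "\<lambda>s. (real i + s) / real n"]
      by (intro integral_cong_AE) (auto intro: borel_measurable_integrable)
    then show "(\<integral>s. g (p \<lfloor>real n * ((real i + s) / real n)\<rfloor>) \<partial>circ) = g (p (int i))"
      by (simp add: measure_restrict_space)
  qed
  finally show ?thesis .
qed

text \<open>Ceiling and floor plus one differ only at integers, where the fractional part removes
  the term.\<close>

lemma spline1_alt: "spline1 n p t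
    = p \<lfloor>real n * t\<rfloor> + frac (real n * t) *\<^sub>R (p (\<lfloor>real n * t\<rfloor> + 1) - p \<lfloor>real n * t\<rfloor>)"
proof (cases "frac (real n * t) = 0")
  case False
  then have "\<lceil>real n * t\<rceil> = \<lfloor>real n * t\<rfloor> + 1"
    by (simp add: ceiling_altdef frac_def)
  then show ?thesis by (simp add: spline1_def)
qed (simp add: spline1_def)

text \<open>A window of one mesh width around \<open>t\<close> meets the plateaus of
  \<open>i\<close> and \<open>i + 1\<close>, and the second fills the fraction
  \<open>\<theta>\<close> of it.\<close>

lemma avg_step:
  fixes p :: "int \<Rightarrow> real ^ 'd"
  assumes n: "n \<ge> 1"
  shows "avg (1 / real n) (step n p) = spline1 n p"
proof
  fix t
  define y i \<theta> where "y = real n * t" and "i = \<lfloor>y\<rfloor>" and "\<theta> = frac y"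
  have \<theta>: "0 \<le> \<theta>" "\<theta> < 1" "y = i + \<theta>" unfolding \<theta>_def i_def
    by (simp_all add: frac_lt_1, simp add: frac_def)
  have "step n p (t + 1 / real n * (s - 1 / 2))
      = p i + indicator {1 - \<theta>..1} s *\<^sub>R (p (i + 1) - p i)"
    if "s \<in> space circ" for s
  proof -
    have "real n * (t + 1 / real n * (s - 1 / 2)) + 1 / 2 = y + s"
      using n by (simp add: y_def field_simps)
    moreover have "\<lfloor>y + s\<rfloor> = (if s < 1 - \<theta> then i else i + 1)"
      using that \<theta> by (auto simp: floor_eq_iff)
    ultimately show ?thesis using that by (auto simp: step_def indicator_def)
  qed
  then have "avg (1 / real n) (step n p) t
      = (\<integral>s. p i + indicator {1 - \<theta>..1} s *\<^sub>R (p (i + 1) - p i) \<partial>circ)"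
    unfolding avg_def by (intro Bochner_Integration.integral_cong) auto
  also have "\<dots> = p i + \<theta> *\<^sub>R (p (i + 1) - p i)"
  proof -
    have [measurable]: "{1 - \<theta>..1} \<in> sets circ" using \<theta> by (auto simp: sets_restrict_space_iff)
    have "measure circ {1 - \<theta>..1} = \<theta>" using \<theta> by (simp add: measure_restrict_space)
    moreover have "integrable circ (indicat_real {1 - \<theta>..1})"
      by (rule integrable_circ_bounded[of _ 1]) (auto simp: indicator_def)
    moreover have "(\<integral>s. indicat_real {1 - \<theta>..1} s \<partial>circ) = measure circ {1 - \<theta>..1}"
      using \<theta> by simp
    ultimately show ?thesis by (simp add: measure_restrict_space)
  qed
  finally show "avg (1 / real n) (step n p) t = spline1 n p t"
    by (simp add: spline1_alt y_def i_def \<theta>_def)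
qed

text \<open>A centred difference evaluates half an index to either side, whereas
  \<open>discrete_deriv\<close> looks backward; the offset therefore grows by a half with each
  order.\<close>

lemma diffq_step:
  assumes n: "n \<ge> 1"
  shows "(diffq (1 / real n) ^^ r) (step n p) t
      = real n ^ r *\<^sub>R discrete_deriv r p \<lfloor>real n * t + (1 + real r) / 2\<rfloor>"
proof (induction r arbitrary: t)
  case (Suc r)
  have e: "real n * (t + 1 / real n / 2) + (1 + real r) / 2 = real n * t + (1 + real (Suc r)) / 2"
    "real n * (t - 1 / real n / 2) + (1 + real r) / 2
        = (real n * t + (1 + real (Suc r)) / 2) - of_int 1"
    using n by (simp_all add: field_simps)
  have "(diffq (1 / real n) ^^ Suc r) (step n p) t
      = real n *\<^sub>R ((diffq (1 / real n) ^^ r) (step n p) (t + 1 / real n / 2)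
      - (diffq (1 / real n) ^^ r) (step n p) (t - 1 / real n / 2))"
    by (simp add: diffq_def[of _ "(diffq (1 / real n) ^^ r) (step n p)"])
  then show ?case
    by (simp only: Suc e floor_diff_of_int discrete_deriv_Suc scaleR_diff_right scaleR_scaleR
        power_Suc)
qed (simp add: step_def)

section \<open>Iterated averages and weak derivatives\<close>

lemma bpm_avg_funpow: "bpm u \<Longrightarrow> bpm ((avg w ^^ k) u)"
  by (induction k) (auto intro: bpm_avg)

lemma bpm_diffq_funpow: "bpm u \<Longrightarrow> bpm ((diffq w ^^ k) u)"
  by (induction k) (auto intro: bpm_diffq)

lemma avg_funpow_diffq: "bpm u \<Longrightarrow> (avg w ^^ k) (diffq w u) = diffq w ((avg w ^^ k) u)"
  by (induction k) (auto simp: avg_diffq bpm_avg_funpow)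

lemma avg_funpow_diff:
  assumes "bpm u" "bpm v" shows "(avg w ^^ k) (\<lambda>t. u t - v t)
      = (\<lambda>t. (avg w ^^ k) u t - (avg w ^^ k) v t)"
proof (induction k)
  case (Suc k)
  then show ?case using avg_diff[OF bpm_avg_funpow[OF assms(1)] bpm_avg_funpow[OF assms(2)]] by auto
qed simp

lemma integral_avg_funpow_powr_le:
  assumes N: "is_norm N" "q \<ge> 1" and u: "bpm u"
  shows "(\<integral>t. N ((avg w ^^ k) u t) powr q \<partial>circ) \<le> (\<integral>t. N (u t) powr q \<partial>circ)"
proof (induction k)
  case (Suc k)
  then show ?case using order_trans[OF integral_avg_powr_le[OF N bpm_avg_funpow[OF u]] Suc.IH]
    by simp
qed simp

text \<open>Periodicity passes to derivatives by uniqueness of the derivative, and continuity then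
  gives boundedness.\<close>

lemma periodic_test_function_deriv:
  assumes "periodic_test_function \<phi>"
  shows "((deriv ^^ k) \<phi> has_vector_derivative (deriv ^^ Suc k) \<phi> t) (at t)" "bpm ((deriv ^^ k) \<phi>)"
proof -
  have D: "((deriv ^^ k) \<phi> has_real_derivative (deriv ^^ Suc k) \<phi> t) (at t)" for t k
    using assms field_differentiable_derivI unfolding periodic_test_function_def by fastforce
  then show "((deriv ^^ k) \<phi> has_vector_derivative (deriv ^^ Suc k) \<phi> t) (at t)" for t
    by (simp add: has_real_derivative_iff_has_vector_derivative)
  have "(deriv ^^ k) \<phi> (t + 1) = (deriv ^^ k) \<phi> t" for t
  proof (induction k arbitrary: t)
    case 0 then show ?case using assms by (simp add: periodic_test_function_def periodic1_def)
  next
    case (Suc k)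
    have "((\<lambda>x. (deriv ^^ k) \<phi> (x + 1)) has_real_derivative (deriv ^^ Suc k) \<phi> (t + 1)) (at t)"
      using D DERIV_shift by blast
    then show ?case using D[of k t] Suc DERIV_unique by auto
  qed
  then show "bpm ((deriv ^^ k) \<phi>)"
    by (intro bpm_continuous continuous_at_imp_continuous_on ballI DERIV_isCont[OF D])
qed

text \<open>Each derivative of \<open>\<phi>\<close> uses up one average and leaves one difference
  quotient, which commutes past the remaining averages.\<close>

lemma integral_deriv_avg_funpow:
  assumes \<phi>: "periodic_test_function \<phi>" and w: "w \<noteq> 0" and v: "bpm v"
  shows "(\<integral>t. (deriv ^^ r) \<phi> t *\<^sub>R (avg w ^^ r) v t \<partial>circ)
    = (- 1) ^ r *\<^sub>R (\<integral>t. \<phi> t *\<^sub>R (diffq w ^^ r) v t \<partial>circ)"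
  using v
proof (induction r arbitrary: v)
  case (Suc r)
  have "(\<integral>t. (deriv ^^ Suc r) \<phi> t *\<^sub>R (avg w ^^ Suc r) v t \<partial>circ)
      = - (\<integral>t. (deriv ^^ r) \<phi> t *\<^sub>R (avg w ^^ r) (diffq w v) t \<partial>circ)"
    using integral_deriv_avg[OF periodic_test_function_deriv(1)[OF \<phi>,
        of r] periodic_test_function_deriv(2)[OF \<phi>, of r]
      periodic_test_function_deriv(2)[OF \<phi>, of "Suc r"] bpm_avg_funpow[OF Suc.prems] w]
    by (simp add: avg_funpow_diffq[OF Suc.prems])
  also have "\<dots> = (- 1) ^ Suc r *\<^sub>R (\<integral>t. \<phi> t *\<^sub>R (diffq w ^^ r) (diffq w v) t \<partial>circ)"
    by (simp add: Suc.IH[OF bpm_diffq[OF Suc.prems]])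
  finally show ?case by (simp add: funpow_swap1)
qed simp

text \<open>Strips the root from norm bounds, so that all later comparisons are between integrals or
  sums of \<open>q\<close>-th powers.\<close>

lemma mult_powr_inverse_le_iff:
  fixes c X a q :: real
  assumes "c \<ge> 0" "X \<ge> 0" "a > 0" "q \<ge> 1"
  shows "c * X powr (1 / q) \<le> a \<longleftrightarrow> c powr q * X \<le> a powr q"
proof -
  have "(c * X powr (1 / q)) powr q = c powr q * X"
    using assms by (simp add: powr_mult powr_powr)
  then show ?thesis
    using assms powr_mono2[of q "c * X powr (1 / q)" a]
        powr_less_mono2[of q a "c * X powr (1 / q)"] by fastforce
qed

lemma Lq_norm_le_bpm:
  assumes "is_norm N" "q \<ge> 1" "bpm g" "a > 0"
  shows "Lq_norm_le N q g a \<longleftrightarrow> (\<integral>t. N (g t) powr q \<partial>circ) \<le> a powr q"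
  using mult_powr_inverse_le_iff[of 1 "\<integral>t. N (g t) powr q \<partial>circ" a q] assms
    integrable_bpm[OF bpm_is_norm_powr[OF assms(1-3)]]
  by (simp add: Lq_norm_le_def)

lemma lq_norm_le_iff:
  assumes "is_norm N" "q \<ge> 1" "a > 0"
  shows "real n ^ r * lq_norm N q n p \<le> a \<longleftrightarrow>
    1 / real n * (\<Sum>i<n. N (real n ^ r *\<^sub>R p (int i)) powr q) \<le> a powr q"
proof -
  have eq: "(real n ^ r) powr q * (1 / real n * (\<Sum>i<n. N (p (int i)) powr q))
     = 1 / real n * (\<Sum>i<n. N (real n ^ r *\<^sub>R p (int i)) powr q)"
    using is_norm_nonneg[OF assms(1)]
    by (simp add: is_norm_scaleR[OF assms(1)] powr_mult sum_distrib_left mult.left_commute)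
  have "real n ^ r * lq_norm N q n p \<le> a
      \<longleftrightarrow> (real n ^ r) powr q * (1 / real n * (\<Sum>i<n. N (p (int i)) powr q)) \<le> a powr q"
    unfolding lq_norm_def using assms by (intro mult_powr_inverse_le_iff) (auto simp: sum_nonneg)
  then show ?thesis by (simp only: eq)
qed

text \<open>The exact dictionary between the discrete norms of \<open>p\<close> and the integral
  norms of the difference quotients of its step function.\<close>

lemma integral_diffq_step_powr:
  assumes N: "is_norm N" "q \<ge> 1" and p: "discretized_curve n p" "n \<ge> 1"
  shows "(\<integral>t. N ((diffq (1 / real n) ^^ r) (step n p) t) powr q \<partial>circ)
    = 1 / real n * (\<Sum>i<n. N (real n ^ r *\<^sub>R discrete_deriv r p (int i)) powr q)"
proof -
  have "continuous_on UNIV (\<lambda>x. N (real n ^ r *\<^sub>R x) powr q)"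
    by (rule continuous_on_compose2[OF continuous_on_is_norm_powr[OF N,
        of UNIV]]) (auto intro: continuous_intros)
  from integral_floor[OF discretized_curve_discrete_deriv[OF p(1)] p(2) this]
  show ?thesis by (simp add: diffq_step[OF p(2)])
qed

lemma smoothed_step_in_sobolev_multiball:
  assumes N: "is_norm N" "q \<ge> 1" and n: "n \<ge> 1" and \<alpha>: "\<And>r. r \<le> m \<Longrightarrow> \<alpha> r > 0"
    and p: "p \<in> discrete_multiball N m q n \<alpha>"
  shows "(avg (1 / real n) ^^ m) (step n p) \<in> sobolev_multiball N m q \<alpha>"
proof -
  let ?w = "1 / real n" and ?v = "step n p"
  let ?f = "(avg ?w ^^ m) ?v"
  have pd: "discretized_curve n p" using p by (simp add: discrete_multiball_def)
  have v: "bpm ?v" by (rule bpm_step[OF pd n])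
  have f: "bpm ?f" by (rule bpm_avg_funpow[OF v])
  have "\<exists>g. has_periodic_weak_deriv r ?f g \<and> Lq_norm_le N q g (\<alpha> r)" if r: "r \<le> m" for r
  proof (intro exI conjI)
    \<comment> \<open>Of the \<open>m\<close> averages, \<open>r\<close> are traded for difference
      quotients; the other \<open>m - r\<close> only contract the norm.\<close>
    let ?g = "(avg ?w ^^ (m - r)) ((diffq ?w ^^ r) ?v)"
    have g: "bpm ?g" by (intro bpm_avg_funpow bpm_diffq_funpow v)
    have fe: "?f = (avg ?w ^^ r) ((avg ?w ^^ (m - r)) ?v)"
      using r by (metis funpow_add le_add_diff_inverse o_apply)
    have ge: "?g = (diffq ?w ^^ r) ((avg ?w ^^ (m - r)) ?v)"
    proof -
      have "(avg ?w ^^ k) ((diffq ?w ^^ r) ?v) = (diffq ?w ^^ r) ((avg ?w ^^ k) ?v)" for k r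
        by (induction r) (simp_all add: avg_funpow_diffq bpm_diffq_funpow v)
      then show ?thesis by blast
    qed
    show "has_periodic_weak_deriv r ?f ?g"
      unfolding has_periodic_weak_deriv_def
    proof (intro conjI allI impI integrable_bpm f g)
      fix \<phi> assume "periodic_test_function \<phi>"
      from integral_deriv_avg_funpow[OF this,
          of ?w "(avg ?w ^^ (m - r)) ?v" r] bpm_avg_funpow[OF v] n
      show "(\<integral>t. (deriv ^^ r) \<phi> t *\<^sub>R ?f t \<partial>circ) = (- 1) ^ r *\<^sub>R (\<integral>t. \<phi> t *\<^sub>R ?g t \<partial>circ)"
        unfolding ge by (simp only: fe) simp
    qed
    have "(\<integral>t. N (?g t) powr q \<partial>circ) \<le> (\<integral>t. N ((diffq ?w ^^ r) ?v t) powr q \<partial>circ)"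
      by (intro integral_avg_funpow_powr_le N bpm_diffq_funpow v)
    also have "\<dots> \<le> \<alpha> r powr q"
      using p r lq_norm_le_iff[OF N \<alpha>[OF r], of n r "discrete_deriv r p"]
      by (simp add: integral_diffq_step_powr[OF N pd n] discrete_multiball_def)
    finally show "Lq_norm_le N q ?g (\<alpha> r)" using Lq_norm_le_bpm[OF N g \<alpha>[OF r]] by simp
  qed
  then show ?thesis using f integrable_bpm[OF f] by (auto simp: sobolev_multiball_def bpm_def)
qed

section \<open>The error of averaging a spline\<close>

lemma integral_centered: "(\<integral>s. A + c * (s - 1 / 2) \<partial>circ) = (A::real)"
proof -
  have "((\<lambda>s. A + c * (s - 1 / 2)) has_integral (A * 1
      + c * ((1\<^sup>2 / 2 - 0\<^sup>2 / 2) - 1 / 2 * 1))) {0..1::real}"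
    using has_integral_const_real[of _ 0 1]
      ident_has_integral[of 0 "1::real"]
    by (intro has_integral_add has_integral_mult_right has_integral_diff) auto
  moreover have "integrable circ (\<lambda>s. A + c * (s - 1 / 2))"
    by (intro continuous_imp_integrable_real continuous_intros)
  ultimately show ?thesis
    by (simp add: lebesgue_integral_eq_integral integral_unique)
qed

text \<open>The slope \<open>c\<close> integrates to zero over a centred window. This is how
  first-order terms disappear from every error estimate.\<close>

lemma inner_avg_le:
  assumes u: "bpm u" and le: "\<And>s. 0 \<le> s \<Longrightarrow> s \<le> 1 \<Longrightarrow> a \<bullet> u (t + w * (s - 1 / 2)) \<le> A + c * (s - 1 / 2)"
  shows "a \<bullet> avg w u t \<le> A"
proof -
  have "a \<bullet> avg w u t = (\<integral>s. a \<bullet> u (t + w * (s - 1 / 2)) \<partial>circ)"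
    using integrable_avg[OF u] by (simp add: avg_def)
  also have "\<dots> \<le> (\<integral>s. A + c * (s - 1 / 2) \<partial>circ)"
  proof (rule integral_mono)
    show "integrable circ (\<lambda>s. A + c * (s - 1 / 2))"
      by (intro continuous_imp_integrable_real continuous_intros)
  qed (use integrable_avg[OF u] le in auto)
  finally show ?thesis by (simp only: integral_centered)
qed

lemma curve_dist_eq_integral:
  assumes "is_norm N" "integrable circ f" "integrable circ g"
  shows "curve_dist N f g = ennreal (\<integral>t. N (f t - g t) \<partial>circ)"
  unfolding curve_dist_def
  by (intro nn_integral_eq_integral integrable_is_norm assms Bochner_Integration.integrable_diff)
     (simp add: is_norm_nonneg[OF assms(1)])

lemma is_norm_ge_abs_inner:
  assumes "is_norm N" "\<And>y. a \<bullet> y \<le> N y" shows "\<bar>a \<bullet> x\<bar> \<le> N x"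
  using assms(2)[of x] assms(2)[of "- x"] by (simp add: is_norm_minus[OF assms(1)] abs_le_iff)

lemma powr_le_cancel_base:
  fixes x a q :: real
  assumes "x powr q \<le> a powr q" "a \<ge> 0" "q > 0" shows "x \<le> a"
  using assms powr_less_mono2[of q a x] by linarith

text \<open>In mesh units a displacement of at most one half crosses at most one node. Beyond that
  node \<open>G\<close> leaves the line through its current piece by the overshoot, at most one
  half, times the second difference there. Both neighbouring nodes are charged since the sign of
  \<open>z\<close> is open.\<close>

lemma piecewise_linear_taylor:
  fixes \<phi> :: "int \<Rightarrow> real" and y z :: real
  defines "G \<equiv> \<lambda>y. \<phi> \<lfloor>y\<rfloor> + frac y * (\<phi> (\<lfloor>y\<rfloor> + 1) - \<phi> \<lfloor>y\<rfloor>)"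
  assumes z: "\<bar>z\<bar> \<le> 1 / 2"
  shows "G (y + z) \<le> G y + z * (\<phi> (\<lfloor>y\<rfloor> + 1) - \<phi> \<lfloor>y\<rfloor>)
    + 1 / 2 * (\<bar>\<phi> (\<lfloor>y\<rfloor> + 2) - 2 * \<phi> (\<lfloor>y\<rfloor> + 1) + \<phi> \<lfloor>y\<rfloor>\<bar>
      + \<bar>\<phi> (\<lfloor>y\<rfloor> + 1) - 2 * \<phi> \<lfloor>y\<rfloor> + \<phi> (\<lfloor>y\<rfloor> - 1)\<bar>)"
proof -
  define i where "i = \<lfloor>y\<rfloor>"
  have y: "y = i + frac y" "0 \<le> frac y" "frac y < 1" unfolding i_def
    by (simp add: frac_def, simp, rule frac_lt_1)
  have half: "e * d \<le> 1 / 2 * \<bar>d\<bar>" if "0 \<le> e" "e \<le> 1 / 2" for e d :: real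
    using that by (metis abs_ge_self abs_ge_zero mult_left_mono mult_right_mono order_trans)
  have G: "G x = \<phi> j + (x - j) * (\<phi> (j + 1) - \<phi> j)" if "\<lfloor>x\<rfloor> = j" for x j
    using that by (simp add: G_def frac_def)
  have "i - 1 \<le> \<lfloor>y + z\<rfloor>" "\<lfloor>y + z\<rfloor> < i + 2"
    using y z unfolding le_floor_iff floor_less_iff by linarith+
  then consider "\<lfloor>y + z\<rfloor> = i - 1" | "\<lfloor>y + z\<rfloor> = i" | "\<lfloor>y + z\<rfloor> = i + 1" by linarith
  then show ?thesis
  proof cases
    case 1
    \<comment> \<open>The overshoot to the left of node \<open>i\<close>; the case to the right of
      node \<open>i + 1\<close> is symmetric.\<close>
    define e where "e = i - (y + z)"
    have "0 \<le> e" "e \<le> 1 / 2" using 1 y z unfolding e_def floor_eq_iff by linarith+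
    from half[OF this, of "\<phi> (i + 1) - 2 * \<phi> i + \<phi> (i - 1)"]
    have "G (y + z) \<le> G y + z * (\<phi> (i + 1) - \<phi> i) + 1 / 2 * \<bar>\<phi> (i + 1) - 2 * \<phi> i + \<phi> (i - 1)\<bar>"
      by (simp add: G[OF 1] G[OF i_def[symmetric]] e_def algebra_simps)
    then show ?thesis by (rule order_trans) (simp add: i_def)
  next
    case 2
    have "G (y + z) = G y + z * (\<phi> (i + 1) - \<phi> i)"
      by (simp add: G[OF 2] G[OF i_def[symmetric]] algebra_simps)
    then show ?thesis by (simp add: i_def add_divide_distrib)
  next
    case 3
    define e where "e = y + z - (i + 1)"
    have "0 \<le> e" "e \<le> 1 / 2" using 3 y z unfolding e_def floor_eq_iff by (simp, linarith)
    from half[OF this, of "\<phi> (i + 2) - 2 * \<phi> (i + 1) + \<phi> i"]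
    have "G (y + z) \<le> G y + z * (\<phi> (i + 1) - \<phi> i) + 1 / 2 * \<bar>\<phi> (i + 2) - 2 * \<phi> (i + 1) + \<phi> i\<bar>"
      by (simp add: G[OF 3] G[OF i_def[symmetric]] e_def algebra_simps)
    then show ?thesis by (rule order_trans) (simp add: i_def)
  qed
qed

lemma discrete_deriv_2: "discrete_deriv 2 p i = p i - 2 *\<^sub>R p (i - 1) + p (i - 2)"
  by (simp add: numeral_2_eq_2 discrete_deriv_Suc scaleR_2 flip: diff_diff_eq)

text \<open>The supporting functional of the error reduces to the scalar estimate, whose linear term
  the centred window kills. The second difference at index \<open>j\<close> is centred at
  \<open>j - 1\<close>, so the nodes \<open>?i + 1\<close> and \<open>?i\<close> appear as the
  indices \<open>?i + 2\<close> and \<open>?i + 1\<close>.\<close>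

lemma avg_spline1_error:
  assumes N: "is_norm N" and p: "discretized_curve n p" and n: "n \<ge> 1"
  shows "N (avg (1 / real n) (spline1 n p) t - spline1 n p t)
    \<le> 1 / 2 * (N (discrete_deriv 2 p \<lfloor>real n * t + 2\<rfloor>) + N (discrete_deriv 2 p \<lfloor>real n * t + 1\<rfloor>))"
proof -
  let ?g = "spline1 n p" and ?w = "1 / real n"
  let ?i = "\<lfloor>real n * t\<rfloor>"
  define B where "B = 1 / 2 * (N (discrete_deriv 2 p (?i + 2)) + N (discrete_deriv 2 p (?i + 1)))"
  have g: "bpm ?g" using bpm_avg[OF bpm_step[OF p n]] avg_step[OF n] by metis
  obtain a where a: "\<And>y. a \<bullet> y \<le> N y" "a \<bullet> (avg ?w ?g t - ?g t) = N (avg ?w ?g t - ?g t)"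
    using supporting_functional[OF N] by metis
  define \<phi> where "\<phi> i = a \<bullet> p i" for i
  have ag: "a \<bullet> ?g t = \<phi> \<lfloor>real n * t\<rfloor> + frac (real n * t) * (\<phi> (\<lfloor>real n * t\<rfloor>
      + 1) - \<phi> \<lfloor>real n * t\<rfloor>)" for t
    by (simp add: spline1_alt \<phi>_def inner_add_right inner_diff_right)
  have d2: "\<bar>\<phi> i - 2 * \<phi> (i - 1) + \<phi> (i - 2)\<bar> \<le> N (discrete_deriv 2 p i)" for i
    using is_norm_ge_abs_inner[OF N a(1), of "discrete_deriv 2 p i"]
    by (simp add: discrete_deriv_2 \<phi>_def inner_add_right inner_diff_right)
  have "a \<bullet> avg ?w ?g t \<le> a \<bullet> ?g t + B"
  proof (rule inner_avg_le[OF g, where c = "\<phi> (?i + 1) - \<phi> ?i"])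
    fix s :: real assume s: "0 \<le> s" "s \<le> 1"
    then have z: "\<bar>s - 1 / 2\<bar> \<le> 1 / 2" by linarith
    have e: "real n * (t + ?w * (s - 1 / 2)) = real n * t + (s - 1 / 2)" using n
      by (simp add: field_simps)
    show "a \<bullet> ?g (t + ?w * (s - 1 / 2)) \<le> a \<bullet> ?g t + B + (\<phi> (?i + 1) - \<phi> ?i) * (s - 1 / 2)"
      unfolding ag e B_def using piecewise_linear_taylor[OF z, of \<phi> "real n * t"] d2[of "?i
          + 2"] d2[of "?i + 1"]
      by (simp add: algebra_simps)
  qed
  then have "N (avg ?w ?g t - ?g t) \<le> B" using a(2) unfolding inner_diff_right by linarith
  then show ?thesis by (simp add: B_def)
qed

lemma spline1_near_sobolev:
  assumes N: "is_norm N" "q \<ge> 1" and n: "n \<ge> 1" and m: "m \<ge> 2" and \<alpha>: "\<And>r. r \<le> m \<Longrightarrow> \<alpha> r > 0"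
    and p: "p \<in> discrete_multiball N m q n \<alpha>"
  shows "\<exists>f\<in>sobolev_multiball N m q \<alpha>. curve_dist N (spline1 n p) f
      \<le> ennreal (real (m - 1) * \<alpha> 2 / real n ^ 2)"
proof (rule bexI)
  let ?w = "1 / real n" and ?v = "step n p" and ?g = "spline1 n p"
  let ?f = "(avg ?w ^^ m) ?v"
  show "?f \<in> sobolev_multiball N m q \<alpha>"
    by (rule smoothed_step_in_sobolev_multiball[OF N n \<alpha> p])
  have pd: "discretized_curve n p" using p by (simp add: discrete_multiball_def)
  have v: "bpm ?v" by (rule bpm_step[OF pd n])
  have g: "bpm ?g" using bpm_avg[OF v] avg_step[OF n] by metis
  have dg: "bpm (\<lambda>t. avg ?w ?g t - ?g t)" by (intro bpm_diff bpm_avg g)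
  define \<beta> where "\<beta> = 1 / real n * (\<Sum>i<n. N (discrete_deriv 2 p (int i)))"
  have dd: "discretized_curve n (discrete_deriv 2 p)"
    by (rule discretized_curve_discrete_deriv[OF pd])
  have fl: "(\<integral>t. N (discrete_deriv 2 p \<lfloor>real n * t + c\<rfloor>) \<partial>circ) = \<beta>" for c
    unfolding \<beta>_def by (rule integral_floor[OF dd n continuous_on_is_norm[OF N(1)]])
  have fi: "integrable circ (\<lambda>t. N (discrete_deriv 2 p \<lfloor>real n * t + c\<rfloor>))" for c
    by (intro integrable_bpm bpm_is_norm N(1) bpm_floor dd n)
  have "(\<integral>t. N (avg ?w ?g t - ?g t) \<partial>circ)
      \<le> (\<integral>t. 1 / 2 * (N (discrete_deriv 2 p \<lfloor>real n * t + 2\<rfloor>) + N (discrete_deriv 2 p \<lfloor>real n * t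
          + 1\<rfloor>)) \<partial>circ)"
    by (intro integral_mono avg_spline1_error[OF N(1) pd n]
        integrable_bpm[OF bpm_is_norm[OF N(1) dg]]
        integrable_mult_right Bochner_Integration.integrable_add fi)
  also have "\<dots> = 1 / 2 * (\<beta> + \<beta>)"
    by (simp only: integral_mult_right_zero Bochner_Integration.integral_add[OF fi fi] fl)
  also have "\<dots> = \<beta>" by simp
  finally have E: "(\<integral>t. N (avg ?w ?g t - ?g t) \<partial>circ) \<le> \<beta>" .
  have \<beta>: "\<beta> \<le> \<alpha> 2 / real n ^ 2"
  proof -
    \<comment> \<open>Its values are \<open>n^2\<close> times the second differences of
      \<open>p\<close>, so its mean norm is \<open>n^2 * \<beta>\<close>; the mean is bounded by the
      \<open>q\<close>-norm.\<close>
    let ?u = "(diffq ?w ^^ 2) ?v"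
    have "(\<integral>t. N (?u t) \<partial>circ) powr q \<le> (\<integral>t. N (?u t) powr q \<partial>circ)"
      by (intro integral_powr_mono N bpm_diffq_funpow v)
    also have "\<dots> \<le> \<alpha> 2 powr q"
      using p m lq_norm_le_iff[OF N \<alpha>[OF m], of n 2 "discrete_deriv 2 p"]
      by (simp add: integral_diffq_step_powr[OF N pd n] discrete_multiball_def)
    finally have "(\<integral>t. N (?u t) \<partial>circ) \<le> \<alpha> 2"
      by (rule powr_le_cancel_base) (use \<alpha>[OF m] N in auto)
    moreover have "(\<integral>t. N (?u t) \<partial>circ) = real n ^ 2 * \<beta>"
      by (simp add: diffq_step[OF n] is_norm_scaleR[OF N(1)] fl)
    ultimately show ?thesis using n by (simp add: field_simps)
  qed
  have "(\<integral>t. N ((avg ?w ^^ k) ?g t - ?g t) \<partial>circ) \<le> real k * \<beta>" for k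
  proof (induction k)
    case 0 then show ?case by (simp add: is_norm_zero[OF N(1)])
  next
    case (Suc k)
    let ?a = "(avg ?w ^^ Suc k) ?g" and ?b = "(avg ?w ^^ k) ?g"
    have ab: "bpm ?a" "bpm ?b" by (intro bpm_avg_funpow g)+
    have "(\<integral>t. N (?a t - ?g t) \<partial>circ) \<le> (\<integral>t. N (?a t - ?b t) + N (?b t - ?g t) \<partial>circ)"
      by (intro integral_mono is_norm_diff_triangle[OF N(1)]
          Bochner_Integration.integrable_add integrable_bpm bpm_is_norm bpm_diff N ab g)
    also have "\<dots> = (\<integral>t. N (?a t - ?b t) \<partial>circ) + (\<integral>t. N (?b t - ?g t) \<partial>circ)"
      by (intro Bochner_Integration.integral_add integrable_bpm bpm_is_norm bpm_diff N ab g)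
    \<comment> \<open>By linearity the step from \<open>k\<close> to \<open>k + 1\<close> averages
      is the first step averaged \<open>k\<close> times, and averaging contracts; this is the case
      of exponent 1.\<close>
    also have "(\<lambda>t. ?a t - ?b t) = (avg ?w ^^ k) (\<lambda>t. avg ?w ?g t - ?g t)"
      by (simp add: avg_funpow_diff bpm_avg g funpow_swap1)
    then have "(\<integral>t. N (?a t - ?b t) \<partial>circ) \<le> (\<integral>t. N (avg ?w ?g t - ?g t) \<partial>circ)"
      using integral_avg_funpow_powr_le[OF N(1) _ dg, of 1 k ?w] is_norm_nonneg[OF N(1)]
        by (simp add: fun_eq_iff)
    finally show ?case using Suc E by (simp add: algebra_simps)
  qed
  \<comment> \<open>The spline is itself the first average of the step function, which leaves
    \<open>m - 1\<close> averages to pay for.\<close>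
  from this[of "m - 1"] have "(\<integral>t. N (?f t - ?g t) \<partial>circ) \<le> real (m - 1) * \<beta>"
    using m avg_step[OF n, of p] by (cases m) (simp_all add: funpow_Suc_right del: funpow.simps)
  also have "\<dots> \<le> real (m - 1) * (\<alpha> 2 / real n ^ 2)" by (intro mult_left_mono \<beta>) simp
  finally show "curve_dist N ?g ?f \<le> ennreal (real (m - 1) * \<alpha> 2 / real n ^ 2)"
    by (simp add: curve_dist_eq_integral[OF N(1) integrable_bpm[OF g]
        integrable_bpm[OF bpm_avg_funpow[OF v]]] is_norm_diff_commute[OF N(1),
            of "?g _"] ennreal_leI)
qed

section \<open>Splines near smooth functions\<close>

lemma avg_eq_integral:
  assumes v: "bpm v" and w: "w > 0"
  shows "w *\<^sub>R avg w v t = integral {t - w / 2..t + w / 2} v"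
proof -
  have "(v has_integral integral {t - w / 2..t + w / 2} v) (cbox (t - w / 2) (t + w / 2))"
    using bpm_integrable_on[OF v] by (simp add: has_integral_integral)
  from has_integral_affinity[OF this, of w "t - w / 2"] w
  have *: "((\<lambda>x. v (w * x + (t - w / 2))) has_integral (1 / w) *\<^sub>R integral {t - w / 2..t
      + w / 2} v)
      ((\<lambda>x. (1 / w) *\<^sub>R x + - ((1 / w) *\<^sub>R (t - w / 2))) ` cbox (t - w / 2) (t + w / 2))"
    by simp
  have "((\<lambda>x. (1 / w) *\<^sub>R x + - ((1 / w) *\<^sub>R (t - w / 2))) ` cbox (t - w / 2) (t + w / 2)) = {0..1}"
    using w image_affinity_atLeastAtMost_diff[of "1 / w" "(t - w / 2) / w" "t - w / 2" "t + w / 2"]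
    by (simp add: diff_divide_distrib add_divide_distrib algebra_simps)
  with * have "((\<lambda>s. v (t + w * (s - 1 / 2))) has_integral (1 / w) *\<^sub>R integral {t - w / 2..t
      + w / 2} v) {0..1}"
    by (simp add: algebra_simps)
  moreover have "avg w v t = integral {0..1} (\<lambda>s. v (t + w * (s - 1 / 2)))"
    unfolding avg_def by (rule circ_integral_eq[OF _ v]) measurable
  ultimately show ?thesis using w by (simp add: integral_unique)
qed

text \<open>The range of integration is enlarged to the whole window, which makes the bound
  independent of \<open>x\<close>.\<close>

lemma inner_increment_le:
  assumes N: "is_norm N" and a: "\<And>y. a \<bullet> y \<le> N y" and F': "bpm F'" and w: "w > 0"
    and F: "\<And>t. (F has_vector_derivative F' t) (at t)" and x: "\<bar>x\<bar> \<le> w / 2"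
  shows "\<bar>a \<bullet> F (t + x) - a \<bullet> F t\<bar> \<le> w * avg w (\<lambda>t. N (F' t)) t"
proof -
  define c d where "c = min t (t + x)" and "d = max t (t + x)"
  have NF: "bpm (\<lambda>t. N (F' t))" by (rule bpm_is_norm[OF N F'])
  have cd: "t - w / 2 \<le> c" "d \<le> t + w / 2" "c \<le> d" using x by (auto simp: c_def d_def)
  have "((\<lambda>s. a \<bullet> F' s) has_integral a \<bullet> F d - a \<bullet> F c) {c..d}"
    using cd by (intro fundamental_theorem_of_calculus)
      (auto intro!: bounded_linear.has_vector_derivative[OF bounded_linear_inner_right]
          has_vector_derivative_at_within[OF F])
  then have "\<bar>a \<bullet> F d - a \<bullet> F c\<bar> \<le> integral {c..d} (\<lambda>t. N (F' t))"
    using integral_norm_bound_integral[of "\<lambda>s. a \<bullet> F' s" "{c..d}" "\<lambda>t. N (F' t)"]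
        is_norm_ge_abs_inner[OF N a]
      bpm_integrable_on[OF NF] by (auto simp: has_integral_iff)
  also have "\<dots> \<le> integral {t - w / 2..t + w / 2} (\<lambda>t. N (F' t))"
    using cd by (intro integral_subset_le bpm_integrable_on NF) (auto simp: is_norm_nonneg[OF N])
  also have "\<dots> = w * avg w (\<lambda>t. N (F' t)) t"
    using avg_eq_integral[OF NF w, of t] by simp
  finally show ?thesis by (auto simp: c_def d_def min_def max_def split: if_splits)
qed

text \<open>The mean value inequality for the function minus its tangent line: its slope is at most
  \<open>w\<close> times the window average, and the displacement at most
  \<open>w / 2\<close>.\<close>

lemma inner_taylor_le:
  assumes N: "is_norm N" and a: "\<And>y. a \<bullet> y \<le> N y" and F'': "bpm F''" and w: "w > 0"
    and F: "\<And>t. (F has_vector_derivative F' t) (at t)"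
        and F': "\<And>t. (F' has_vector_derivative F'' t) (at t)"
    and x: "\<bar>x\<bar> \<le> w / 2"
  shows "a \<bullet> F (t + x) \<le> a \<bullet> F t + x * (a \<bullet> F' t) + w\<^sup>2 / 2 * avg w (\<lambda>t. N (F'' t)) t"
proof -
  let ?I = "avg w (\<lambda>t. N (F'' t)) t"
  have inc: "\<bar>a \<bullet> F' (t + y) - a \<bullet> F' t\<bar> \<le> w * ?I" if "\<bar>y\<bar> \<le> w / 2" for y
    by (rule inner_increment_le[OF N a F'' w F' that])
  have I: "w * ?I \<ge> 0" using inc[of 0] w by simp
  have D: "((\<lambda>y. a \<bullet> F (t + y) - y * (a \<bullet> F' t)) has_real_derivative (a \<bullet> F' (t
      + y) - a \<bullet> F' t)) (at y within S)" for y S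
  proof -
    have "((+) t has_vector_derivative 1) (at y)"
      by (auto intro!: derivative_eq_intros simp flip:
          has_real_derivative_iff_has_vector_derivative)
    then have "((\<lambda>y. F (t + y)) has_vector_derivative F' (t + y)) (at y)"
      using vector_diff_chain_at[where f = "\<lambda>y. t + y" and g = F and x = y and f' = 1] F[of "t + y"]
      by (simp add: o_def)
    from bounded_linear.has_vector_derivative[OF bounded_linear_inner_right this, of a]
    have "((\<lambda>y. a \<bullet> F (t + y)) has_real_derivative a \<bullet> F' (t + y)) (at y)"
      by (simp add: has_real_derivative_iff_has_vector_derivative)
    moreover have "((\<lambda>y. y * (a \<bullet> F' t)) has_real_derivative a \<bullet> F' t) (at y within S)"
      by (auto intro!: derivative_eq_intros)
    ultimately show ?thesis by (rule DERIV_diff[OF has_field_derivative_at_within])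
  qed
  have "norm ((a \<bullet> F (t + x) - x * (a \<bullet> F' t)) - (a \<bullet> F (t + 0) - 0 * (a \<bullet> F' t)))
      \<le> w * ?I * norm (x - 0)"
  proof (rule field_differentiable_bound[OF convex_closed_segment D])
    show "norm (a \<bullet> F' (t + z) - a \<bullet> F' t) \<le> w * ?I" if "z \<in> closed_segment 0 x" for z
      using that x by (auto intro!: inc simp: closed_segment_eq_real_ivl split: if_splits)
  qed auto
  also have "\<dots> \<le> w * ?I * (w / 2)" using x I by (intro mult_left_mono) auto
  finally have "\<bar>(a \<bullet> F (t + x) - x * (a \<bullet> F' t)) - a \<bullet> F t\<bar> \<le> w * ?I * (w / 2)"
    by simp
  from abs_le_D1[OF this] show ?thesis by (simp add: power2_eq_square algebra_simps)
qed

section \<open>Samples of a smooth function\<close>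

definition sample :: "nat \<Rightarrow> (real \<Rightarrow> 'a) \<Rightarrow> int \<Rightarrow> 'a" where
  "sample n u i = u (of_int i / real n)"

lemma discretized_curve_sample:
  assumes "bpm u" "n \<ge> 1" shows "discretized_curve n (sample n u)"
  unfolding discretized_curve_def sample_def
proof
  fix i
  have "of_int i / real n = of_int (i mod int n) / real n + of_int (i div int n)"
  proof -
    have "real_of_int i = of_int (i mod int n) + of_int (i div int n) * real n"
      by (metis mod_div_mult_eq of_int_add of_int_mult of_int_of_nat_eq)
    then show ?thesis using assms(2) by (simp add: add_divide_distrib)
  qed
  then show "u (of_int i / real n) = u (of_int (i mod int n) / real n)"
    by (simp add: bpm_periodic_int[OF assms(1)])
qed

text \<open>Backward differences of samples are centred differences taken half a mesh earlier for
  each order, whence the shift by \<open>r / (2 * n)\<close>.\<close>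

lemma discrete_deriv_sample:
  assumes "n \<ge> 1"
  shows "real n ^ r *\<^sub>R discrete_deriv r (sample n u) i
      = (diffq (1 / real n) ^^ r) u (of_int i / real n - real r / (2 * real n))"
proof (induction r arbitrary: i)
  case (Suc r)
  have e: "of_int (i - 1) / real n - real r / (2 * real n)
      = of_int i / real n - real (Suc r) / (2 * real n) - 1 / real n / 2"
    "of_int i / real n - real r / (2 * real n)
        = of_int i / real n - real (Suc r) / (2 * real n) + 1 / real n / 2"
    using assms by (simp_all add: field_simps)
  have "real n ^ Suc r *\<^sub>R discrete_deriv (Suc r) (sample n u) i
      = real n *\<^sub>R (real n ^ r *\<^sub>R discrete_deriv r (sample n u) i - real n ^ r *\<^sub>R discrete_deriv
          r (sample n u) (i - 1))"
    by (simp add: discrete_deriv_Suc algebra_simps)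
  then show ?case unfolding Suc e by (simp add: diffq_def[of _ "(diffq (1 / real n) ^^ r) u"])
qed (simp add: sample_def)

text \<open>The windows around the nodes tile a period whatever their common offset
  \<open>c\<close>, so the shift of the preceding lemma is harmless.\<close>

lemma sum_avg_tiles:
  fixes v :: "real \<Rightarrow> real"
  assumes v: "bpm v" and n: "n \<ge> 1"
  shows "1 / real n * (\<Sum>i<n. avg (1 / real n) v (of_int (int i) / real n + c)) = (\<integral>t. v t \<partial>circ)"
proof -
  have e: "(real i + s) / real n + (c - 1 / (2 * real n))
      = of_int (int i) / real n + c + 1 / real n * (s - 1 / 2)" for i s
    using n by (simp add: field_simps)
  have "(\<integral>t. v t \<partial>circ) = (\<integral>t. v (t + (c - 1 / (2 * real n))) \<partial>circ)"
    by (simp only: integral_unit_shift[OF v])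
  also have "\<dots> = 1 / real n * (\<Sum>i<n. avg (1 / real n) v (of_int (int i) / real n + c))"
    by (subst integral_unit_tiles[OF bpm_shift[OF v] n]) (simp only: e avg_def real_scaleR_def)
  finally show ?thesis ..
qed

lemma smooth_near_spline1:
  fixes F :: "nat \<Rightarrow> real \<Rightarrow> real ^ 'd"
  assumes N: "is_norm N" "q \<ge> 1" and n: "n \<ge> 1" and m: "m \<ge> 2" and \<alpha>: "\<And>r. r \<le> m \<Longrightarrow> \<alpha> r > 0"
    and F: "\<And>r. r \<le> m \<Longrightarrow> bpm (F r)"
    and D: "\<And>r t. r < m \<Longrightarrow> (F r has_vector_derivative F (Suc r) t) (at t)"
    and le: "\<And>r. r \<le> m \<Longrightarrow> (\<integral>t. N (F r t) powr q \<partial>circ) \<le> \<alpha> r powr q"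
  shows "\<exists>p\<in>discrete_multiball N m q n \<alpha>. curve_dist N (spline1 n p) (F 0)
      \<le> ennreal (9 / 2 * \<alpha> 2 / real n ^ 2)"
proof (rule bexI)
  let ?w = "1 / real n"
  \<comment> \<open>Sampling the average instead of \<open>F 0\<close> replaces point values by
    window means, whose \<open>q\<close>-th powers sum to at most an integral.\<close>
  define p where "p = sample n (avg ?w (F 0))"
  have F0: "bpm (F 0)" and F2: "bpm (F 2)" using F m by auto
  have pd: "discretized_curve n p" unfolding p_def by (intro discretized_curve_sample bpm_avg F0 n)
  \<comment> \<open>Each difference quotient becomes an average of the next derivative.\<close>
  have DF: "(diffq ?w ^^ r) (F 0) = (avg ?w ^^ r) (F r)" if "r \<le> m" for r
    using that
  proof (induction r)
    case (Suc r)
    then have "(diffq ?w ^^ Suc r) (F 0) = (avg ?w ^^ r) (diffq ?w (F r))"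
      by (simp add: avg_funpow_diffq F)
    also have "diffq ?w (F r) = avg ?w (F (Suc r))"
      using Suc n by (intro avg_deriv[symmetric] D F) auto
    finally show ?case by (simp add: funpow_swap1)
  qed simp
  show "p \<in> discrete_multiball N m q n \<alpha>"
    unfolding discrete_multiball_def
  proof (intro CollectI conjI pd allI impI)
    fix r assume r: "r \<le> m"
    let ?u = "(avg ?w ^^ r) (F r)"
    have u: "bpm ?u" by (intro bpm_avg_funpow F r)
    have "(diffq ?w ^^ r) (avg ?w (F 0)) = avg ?w ((diffq ?w ^^ r) (F 0))"
      by (induction r) (simp_all add: avg_diffq bpm_diffq_funpow F0)
    then have "(diffq ?w ^^ r) (avg ?w (F 0)) = avg ?w ?u" by (simp add: DF[OF r])
    then have "1 / real n * (\<Sum>i<n. N (real n ^ r *\<^sub>R discrete_deriv r p (int i)) powr q)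
      = 1 / real n * (\<Sum>i<n. N (avg ?w ?u (of_int (int i) / real n
          + - (real r / (2 * real n)))) powr q)"
      by (simp only: p_def discrete_deriv_sample[OF n] diff_conv_add_uminus)
    also have "\<dots> \<le> 1 / real n * (\<Sum>i<n. avg ?w (\<lambda>t. N (?u t) powr q) (of_int (int i) / real n
        + - (real r / (2 * real n))))"
      by (intro mult_left_mono sum_mono jensen_avg N u) simp
    also have "\<dots> = (\<integral>t. N (?u t) powr q \<partial>circ)"
      by (intro sum_avg_tiles bpm_is_norm_powr N u n)
    also have "\<dots> \<le> (\<integral>t. N (F r t) powr q \<partial>circ)"
      by (intro integral_avg_funpow_powr_le N F r)
    also have "\<dots> \<le> \<alpha> r powr q" by (rule le[OF r])
    finally show "real n ^ r * lq_norm N q n (discrete_deriv r p) \<le> \<alpha> r"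
      using lq_norm_le_iff[OF N \<alpha>[OF r]] by blast
  qed
  have g: "bpm (spline1 n p)" using bpm_avg[OF bpm_step[OF pd n]] avg_step[OF n] by metis
  \<comment> \<open>The two nodes around \<open>t\<close> lie within one mesh width of it and each
    sample reaches half a mesh further, so all arguments stay within \<open>3 / (2 * n)\<close> of
    \<open>t\<close>.\<close>
  let ?I = "avg (3 / real n) (\<lambda>t. N (F 2 t))"
  have pw: "N (spline1 n p t - F 0 t) \<le> 9 / (2 * (real n)\<^sup>2) * ?I t" for t
  proof -
    obtain a where a: "\<And>y. a \<bullet> y \<le> N y" "a \<bullet> (spline1 n p t - F 0 t) = N (spline1 n p t - F 0 t)"
      using supporting_functional[OF N(1)] by metis
    define i \<theta> where "i = \<lfloor>real n * t\<rfloor>" and "\<theta> = frac (real n * t)"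
    have "real n * t = i + \<theta>" by (simp add: i_def \<theta>_def frac_def)
    then have t: "t = (i + \<theta>) / real n" using n by (simp add: field_simps)
    have \<theta>: "0 \<le> \<theta>" "\<theta> < 1" by (simp_all add: \<theta>_def frac_lt_1)
    define W where "W = (3 / real n)\<^sup>2 / 2 * ?I t"
    \<comment> \<open>The offset \<open>s - 1 / 2\<close> inside the sampling window averages out,
      which leaves the Taylor expansion at \<open>t\<close> evaluated at the node
      \<open>j\<close>.\<close>
    have le: "a \<bullet> p j \<le> (a \<bullet> F 0 t + (j - i - \<theta>) / real n * (a \<bullet> F 1 t)) + W" if j: "j = i \<or> j
        = i + 1" for j
      unfolding p_def sample_def
    proof (rule inner_avg_le[OF F0, where c = "(a \<bullet> F 1 t) / real n"])
      fix s :: real assume s: "0 \<le> s" "s \<le> 1"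
      let ?x = "(j - i - \<theta> + (s - 1 / 2)) / real n"
      have "real_of_int (j - i) = 0 \<or> real_of_int (j - i) = 1" using j by auto
      then have "\<bar>j - i - \<theta> + (s - 1 / 2)\<bar> \<le> 3 / 2" using s \<theta> by (elim disjE) linarith+
      from divide_right_mono[OF this, of "real n"]
      have x: "\<bar>?x\<bar> \<le> (3 / real n) / 2" unfolding abs_divide by simp
      have "of_int j / real n + ?w * (s - 1 / 2) = t + ?x" using n by (simp add: t field_simps)
      moreover have "a \<bullet> F 0 (t + ?x) \<le> a \<bullet> F 0 t + ?x * (a \<bullet> F 1 t) + W"
        unfolding W_def using n m D[of 0] D[of 1]
        by (intro inner_taylor_le[OF N(1) a(1) F2 _ _ _ x]) (auto simp: numeral_2_eq_2)
      moreover have "?x * (a \<bullet> F 1 t)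
          = (j - i - \<theta>) / real n * (a \<bullet> F 1 t) + (a \<bullet> F 1 t) / real n * (s - 1 / 2)"
        by (simp add: ring_distribs add_divide_distrib diff_divide_distrib mult.commute)
      ultimately show "a \<bullet> F 0 (of_int j / real n + ?w * (s - 1 / 2))
        \<le> (a \<bullet> F 0 t + (j - i - \<theta>) / real n * (a \<bullet> F 1 t)) + W + (a \<bullet> F 1 t) / real n * (s - 1 / 2)"
        by simp
    qed
    have "a \<bullet> spline1 n p t = (1 - \<theta>) * (a \<bullet> p i) + \<theta> * (a \<bullet> p (i + 1))"
      unfolding spline1_alt i_def[symmetric] \<theta>_def[symmetric]
      by (simp add: inner_add_right inner_diff_right) (simp add: algebra_simps)
    also have "\<dots> \<le> (1 - \<theta>) * ((a \<bullet> F 0 t + (i - i - \<theta>) / real n * (a \<bullet> F 1 t)) + W)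
        + \<theta> * ((a \<bullet> F 0 t + ((i + 1) - i - \<theta>) / real n * (a \<bullet> F 1 t)) + W)"
      using \<theta> by (intro add_mono mult_left_mono le) auto
    \<comment> \<open>The weights \<open>1 - \<theta>\<close> and \<open>\<theta>\<close> meet the
      displacements \<open>- \<theta> / n\<close> and \<open>(1 - \<theta>) / n\<close>, so the
      terms with \<open>F 1\<close> cancel.\<close>
    also have "\<dots> = a \<bullet> F 0 t + W" by (simp add: field_simps)
    finally show ?thesis using a(2) n by (simp add: W_def power_divide inner_diff_right)
  qed
  have "(\<integral>t. N (spline1 n p t - F 0 t) \<partial>circ) \<le> (\<integral>t. 9 / (2 * (real n)\<^sup>2) * ?I t \<partial>circ)"
    by (intro integral_mono pw integrable_mult_right integrable_bpm bpm_avg bpm_is_norm bpm_diff N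
        F0 F2 g)
  also have "\<dots> = 9 / (2 * (real n)\<^sup>2) * (\<integral>t. N (F 2 t) \<partial>circ)"
    by (simp add: integral_unit_avg bpm_is_norm N F2)
  also have "(\<integral>t. N (F 2 t) \<partial>circ) \<le> \<alpha> 2"
    by (rule powr_le_cancel_base[OF order_trans[OF integral_powr_mono[OF N F2]
        le[OF m]]]) (use \<alpha>[OF m] N in auto)
  finally have "(\<integral>t. N (spline1 n p t - F 0 t) \<partial>circ) \<le> 9 / 2 * \<alpha> 2 / real n ^ 2"
    by (simp add: mult_left_mono divide_right_mono)
  then show "curve_dist N (spline1 n p) (F 0) \<le> ennreal (9 / 2 * \<alpha> 2 / real n ^ 2)"
    by (simp add: curve_dist_eq_integral[OF N(1) integrable_bpm[OF g] integrable_bpm[OF F0]]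
        ennreal_leI)
qed

section \<open>Mollification\<close>

text \<open>Trigonometric polynomials are closed under derivatives and reflections, so they are test
  functions for which no smooth bump function has to be constructed.\<close>

inductive trig_poly :: "(real \<Rightarrow> real) \<Rightarrow> bool" where
  const: "trig_poly (\<lambda>_. c)"
| cos: "trig_poly (\<lambda>t. cos (2 * pi * t))"
| sin: "trig_poly (\<lambda>t. sin (2 * pi * t))"
| add: "trig_poly f \<Longrightarrow> trig_poly g \<Longrightarrow> trig_poly (\<lambda>t. f t + g t)"
| mult: "trig_poly f \<Longrightarrow> trig_poly g \<Longrightarrow> trig_poly (\<lambda>t. f t * g t)"

lemma trig_poly_periodic: "trig_poly f \<Longrightarrow> f (t + 1) = f t"
proof (induction rule: trig_poly.induct)
  case cos then show ?case by (simp add: distrib_left)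
next
  case sin then show ?case by (simp add: distrib_left)
qed auto

lemma trig_poly_has_deriv:
  "trig_poly f \<Longrightarrow> \<exists>f'. trig_poly f' \<and> (\<forall>t. (f has_real_derivative f' t) (at t))"
proof (induction rule: trig_poly.induct)
  case (const c)
  show ?case by (intro exI[of _ "\<lambda>_. 0"]) (auto intro: trig_poly.intros)
next
  case cos
  show ?case
    by (intro exI[of _ "\<lambda>t. (- (2 * pi)) * sin (2 * pi * t)"] conjI allI trig_poly.intros)
      (auto intro!: derivative_eq_intros)
next
  case sin
  show ?case
    by (intro exI[of _ "\<lambda>t. (2 * pi) * cos (2 * pi * t)"] conjI allI trig_poly.intros)
      (auto intro!: derivative_eq_intros)
next
  case (add f g)
  then obtain f' g' where "trig_poly f'" "trig_poly g'" "\<And>t. (f has_real_derivative f' t) (at t)"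
    "\<And>t. (g has_real_derivative g' t) (at t)" by blast
  then show ?case by (intro exI[of _ "\<lambda>t. f' t + g' t"] conjI allI trig_poly.intros DERIV_add) auto
next
  case (mult f g)
  then obtain f' g' where "trig_poly f'" "trig_poly g'" "\<And>t. (f has_real_derivative f' t) (at t)"
    "\<And>t. (g has_real_derivative g' t) (at t)" by blast
  then show ?case using mult
    by (intro exI[of _ "\<lambda>t. f t * g' t + f' t * g t"] conjI allI trig_poly.intros DERIV_mult') auto
qed

lemma trig_poly_deriv:
  assumes "trig_poly f"
  shows "trig_poly (deriv f)" "(f has_real_derivative deriv f t) (at t)"
proof -
  obtain f' where f': "trig_poly f'" "\<And>t. (f has_real_derivative f' t) (at t)"
    using trig_poly_has_deriv[OF assms] by blast
  then have "deriv f = f'" by (auto intro: DERIV_imp_deriv)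
  then show "trig_poly (deriv f)" "(f has_real_derivative deriv f t) (at t)" using f' by auto
qed

lemma trig_poly_funpow_deriv: "trig_poly f \<Longrightarrow> trig_poly ((deriv ^^ k) f)"
  by (induction k) (auto intro: trig_poly_deriv)

lemma bpm_trig_poly: assumes "trig_poly f" shows "bpm f"
  by (intro bpm_continuous trig_poly_periodic[OF assms] continuous_at_imp_continuous_on ballI
      DERIV_isCont[OF trig_poly_deriv(2)[OF assms]])

text \<open>The addition formulas. The kernel of a convolution, read as a function of the
  integration variable, is thereby a test function.\<close>

lemma trig_poly_reflect: "trig_poly f \<Longrightarrow> trig_poly (\<lambda>s. f (t - s))"
proof (induction rule: trig_poly.induct)
  case cos
  have "trig_poly (\<lambda>s. cos (2 * pi * t) * cos (2 * pi * s) + sin (2 * pi * t) * sin (2 * pi * s))"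
    by (intro trig_poly.intros)
  then show ?case by (simp add: right_diff_distrib cos_diff)
next
  case sin
  have "trig_poly (\<lambda>s. sin (2 * pi * t) * cos (2 * pi * s)
      + (- cos (2 * pi * t)) * sin (2 * pi * s))"
    by (intro trig_poly.intros)
  then show ?case by (simp add: right_diff_distrib sin_diff)
qed (auto intro: trig_poly.intros)

lemma periodic_test_function_trig_poly: assumes "trig_poly f" shows "periodic_test_function f"
  unfolding periodic_test_function_def periodic1_def
  using trig_poly_periodic[OF assms] trig_poly_deriv(2)[OF trig_poly_funpow_deriv[OF assms]]
  by (auto simp: field_differentiable_def)

lemma funpow_deriv_reflect:
  assumes "trig_poly f"
  shows "(deriv ^^ r) (\<lambda>s. f (t - s)) = (\<lambda>s. (- 1) ^ r * (deriv ^^ r) f (t - s))"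
proof (induction r)
  case (Suc r)
  have "((\<lambda>s. (- 1) ^ r * (deriv ^^ r) f (t - s)) has_real_derivative (- 1) ^ r * ((deriv ^^ Suc
      r) f (t - s) * - 1)) (at s)" for s
  proof -
    have "((-) t has_real_derivative - 1) (at s)" by (auto intro!: derivative_eq_intros)
    from DERIV_cmult[OF DERIV_chain2[OF trig_poly_deriv(2)[OF trig_poly_funpow_deriv[OF assms]]
        this]]
    show ?thesis by simp
  qed
  then have "((\<lambda>s. (- 1) ^ r * (deriv ^^ r) f (t - s)) has_real_derivative (- 1) ^ Suc r * (deriv
      ^^ Suc r) f (t - s)) (at s)" for s
    by simp
  from DERIV_imp_deriv[OF this] show ?case by (simp add: Suc fun_eq_iff)
qed simp

text \<open>Periodicity is carried by \<open>K\<close> alone, so \<open>f\<close> enters only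
  through its values on the unit interval. This suits weak derivatives, which are determined only
  there.\<close>

definition conv :: "(real \<Rightarrow> real) \<Rightarrow> (real \<Rightarrow> 'a::euclidean_space) \<Rightarrow> real \<Rightarrow> 'a" where
  "conv K f t = (\<integral>s. K (t - s) *\<^sub>R f s \<partial>circ)"

lemma integrable_bpm_scaleR:
  fixes f :: "real \<Rightarrow> 'a::euclidean_space"
  assumes K: "bpm K" and f: "integrable circ f" and h: "h \<in> borel_measurable circ"
  shows "integrable circ (\<lambda>s. (K (h s) :: real) *\<^sub>R f s)"
proof -
  obtain B where B: "\<And>t. norm (K t) \<le> B" using bpm_bound[OF K] by metis
  note [measurable] = bpm_measurable[OF K] borel_measurable_integrable[OF f] h
  have "integrable circ (\<lambda>s. B * norm (f s))" using f by simp
  then show ?thesis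
  proof (rule Bochner_Integration.integrable_bound)
    show "AE x in circ. norm (K (h x) *\<^sub>R f x) \<le> norm (B * norm (f x))"
    proof (rule AE_I2)
      fix x
      have "\<bar>K (h x)\<bar> * norm (f x) \<le> B * norm (f x)" using B[of "h x"]
        by (intro mult_right_mono) auto
      then show "norm (K (h x) *\<^sub>R f x) \<le> norm (B * norm (f x))"
        by (simp add: order_trans[OF _ abs_ge_self])
    qed
  qed measurable
qed

lemma integrable_conv:
  fixes f :: "real \<Rightarrow> 'a::euclidean_space"
  shows "bpm K \<Longrightarrow> integrable circ f \<Longrightarrow> integrable circ (\<lambda>s. K (t - s) *\<^sub>R f s)"
  using integrable_bpm_scaleR[of K f "\<lambda>s. t - s"] by simp

text \<open>A quadratic remainder survives integration, which makes differentiation under the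
  integral sign a matter of linearity.\<close>

lemma has_vector_derivative_quadraticI:
  fixes f :: "real \<Rightarrow> 'a::real_normed_vector"
  assumes "\<And>h. norm (f (t + h) - f t - h *\<^sub>R f') \<le> C * h\<^sup>2"
  shows "(f has_vector_derivative f') (at t)"
  unfolding has_vector_derivative_def has_derivative_at'
proof (intro conjI allI impI bounded_linear_scaleR_left)
  fix e :: real assume "e > 0"
  have C: "C \<ge> 0" using order_trans[OF norm_ge_zero assms[of 1]] by simp
  show "\<exists>d>0. \<forall>x'. 0 < norm (x' - t) \<and> norm (x' - t) < d \<longrightarrow>
      norm (f x' - f t - (x' - t) *\<^sub>R f') / norm (x' - t) < e"
  \<comment> \<open>Adding 1 keeps the radius meaningful when \<open>C = 0\<close>.\<close>
  proof (intro exI[of _ "e / (C + 1)"] conjI allI impI)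
    show "e / (C + 1) > 0" using \<open>e > 0\<close> C by simp
    fix x' assume x': "0 < norm (x' - t) \<and> norm (x' - t) < e / (C + 1)"
    define h where "h = x' - t"
    have h: "\<bar>h\<bar> > 0" "\<bar>h\<bar> * (C + 1) < e" using x' C by (auto simp: h_def field_simps)
    have "norm (f (t + h) - f t - h *\<^sub>R f') / \<bar>h\<bar> \<le> (C * \<bar>h\<bar>\<^sup>2) / \<bar>h\<bar>"
      using assms[of h] by (intro divide_right_mono) auto
    also have "\<dots> = C * \<bar>h\<bar>" using h by (simp add: divide_eq_eq power2_eq_square mult.assoc)
    also have "\<dots> \<le> \<bar>h\<bar> * (C + 1)" by (simp add: algebra_simps)
    also have "\<dots> < e" by (rule h)
    finally show "norm (f x' - f t - (x' - t) *\<^sub>R f') / norm (x' - t) < e" by (simp add: h_def)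
  qed
qed

text \<open>The second derivative is continuous and periodic, hence bounded, so one constant serves
  all base points.\<close>

lemma trig_poly_taylor:
  assumes "trig_poly K" obtains C where "\<And>x h. \<bar>K (x + h) - K x - h * deriv K x\<bar> \<le> C * h\<^sup>2"
proof -
  note K' = trig_poly_deriv(1)[OF assms]
  obtain C where C: "\<And>t. norm (deriv (deriv K) t) \<le> C"
    using bpm_bound[OF bpm_trig_poly[OF trig_poly_deriv(1)[OF K']]] by metis
  have C0: "C \<ge> 0" using order_trans[OF norm_ge_zero C] .
  have L: "\<bar>deriv K y - deriv K x\<bar> \<le> C * \<bar>y - x\<bar>" for x y
    using field_differentiable_bound[OF convex_UNIV has_field_derivative_at_within[OF
        trig_poly_deriv(2)[OF K']], of C y x] C by auto
  have "\<bar>K (x + h) - K x - h * deriv K x\<bar> \<le> C * h\<^sup>2" for x h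
  proof -
    have "norm ((K (x + h) - (x + h) * deriv K x) - (K x - x * deriv K x))
        \<le> (C * \<bar>h\<bar>) * norm ((x + h) - x)"
    proof (rule field_differentiable_bound[OF convex_closed_segment])
      fix z assume z: "z \<in> closed_segment x (x + h)"
      show "((\<lambda>z. K z - z * deriv K x) has_real_derivative deriv K z - deriv K x) (at z within
          closed_segment x (x + h))"
        using DERIV_diff[OF has_field_derivative_at_within[OF trig_poly_deriv(2)[OF assms]]
            DERIV_cmult_Id[of "deriv K x"]]
        by (simp add: mult.commute)
      have "\<bar>z - x\<bar> \<le> \<bar>h\<bar>" using z by (auto simp: closed_segment_eq_real_ivl split: if_splits)
      then show "norm (deriv K z - deriv K x) \<le> C * \<bar>h\<bar>"
        using L[of z x] C0 by (auto intro: order_trans mult_left_mono)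
    qed auto
    then show ?thesis by (simp add: algebra_simps power2_eq_square)
  qed
  then show ?thesis using that by blast
qed

text \<open>The uniform Taylor remainder of \<open>K\<close> is integrated against
  \<open>norm (f s)\<close>.\<close>

lemma conv_has_vector_derivative:
  fixes f :: "real \<Rightarrow> 'a::euclidean_space"
  assumes K: "trig_poly K" and f: "integrable circ f"
  shows "(conv K f has_vector_derivative conv (deriv K) f t) (at t)"
proof -
  obtain C where C: "\<And>x h. \<bar>K (x + h) - K x - h * deriv K x\<bar> \<le> C * h\<^sup>2"
    using trig_poly_taylor[OF K] by blast
  note i = integrable_conv[OF bpm_trig_poly[OF K] f]
      integrable_conv[OF bpm_trig_poly[OF trig_poly_deriv(1)[OF K]] f]
  show ?thesis
  proof (rule has_vector_derivative_quadraticI)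
    fix h
    have e: "K (t + h - s) *\<^sub>R f s - K (t - s) *\<^sub>R f s - h *\<^sub>R deriv K (t - s) *\<^sub>R f s
       = (K ((t - s) + h) - K (t - s) - h * deriv K (t - s)) *\<^sub>R f s" for s
      by (simp add: algebra_simps)
    have "conv K f (t + h) - conv K f t - h *\<^sub>R conv (deriv K) f t
      = (\<integral>s. K (t + h - s) *\<^sub>R f s - K (t - s) *\<^sub>R f s - h *\<^sub>R deriv K (t - s) *\<^sub>R f s \<partial>circ)"
      using i by (simp add: conv_def del: scaleR_scaleR)
    also have "norm \<dots> \<le> (\<integral>s. C * h\<^sup>2 * norm (f s) \<partial>circ)"
    proof (rule Bochner_Integration.integral_norm_bound_integral)
      fix s
      show "norm (K (t + h - s) *\<^sub>R f s - K (t - s) *\<^sub>R f s - h *\<^sub>R deriv K (t - s) *\<^sub>R f s)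
          \<le> C * h\<^sup>2 * norm (f s)"
        unfolding e norm_scaleR using C by (intro mult_right_mono) auto
    qed (use i f in \<open>simp_all del: scaleR_scaleR\<close>)
    also have "\<dots> = C * (\<integral>s. norm (f s) \<partial>circ) * h\<^sup>2" by (simp add: algebra_simps)
    finally show "norm (conv K f (t + h) - conv K f t - h *\<^sub>R conv (deriv K) f t)
        \<le> C * (\<integral>s. norm (f s) \<partial>circ) * h\<^sup>2" .
  qed
qed

lemma bpm_conv:
  fixes f :: "real \<Rightarrow> 'a::euclidean_space"
  assumes K: "trig_poly K" and f: "integrable circ f"
  shows "bpm (conv K f)"
proof (rule bpm_continuous)
  show "continuous_on UNIV (conv K f)"
    using conv_has_vector_derivative[OF assms] has_vector_derivative_continuous
    by (intro continuous_at_imp_continuous_on ballI) blast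
  show "conv K f (t + 1) = conv K f t" for t
    using trig_poly_periodic[OF K, of "t - _"] by (simp add: conv_def algebra_simps)
qed

text \<open>The reflected kernel is inserted as test function; the sign from the reflection cancels
  the sign in the definition of the weak derivative.\<close>

lemma conv_weak_deriv:
  assumes K: "trig_poly K" and g: "has_periodic_weak_deriv r f g"
  shows "conv ((deriv ^^ r) K) f t = conv K g t"
proof -
  have "(\<integral>s. (deriv ^^ r) (\<lambda>s. K (t - s)) s *\<^sub>R f s \<partial>circ) = (- 1) ^ r *\<^sub>R conv K g t"
    using g periodic_test_function_trig_poly[OF trig_poly_reflect[OF K, of t]]
    by (simp add: has_periodic_weak_deriv_def conv_def)
  moreover have "(\<integral>s. (deriv ^^ r) (\<lambda>s. K (t - s)) s *\<^sub>R f s \<partial>circ)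
      = (- 1) ^ r *\<^sub>R conv ((deriv ^^ r) K) f t"
    unfolding funpow_deriv_reflect[OF K] conv_def integral_scaleR_right[symmetric] by simp
  ultimately show ?thesis by simp
qed

text \<open>Young's inequality for a probability kernel: Jensen at each \<open>t\<close>, then
  Fubini, since \<open>K (t - s)\<close> has mass 1 in either variable.\<close>

lemma integral_conv_powr_le:
  fixes g :: "real \<Rightarrow> real ^ 'd"
  assumes N: "is_norm N" "q \<ge> 1" and K: "trig_poly K" "\<And>t. K t \<ge> 0" "(\<integral>t. K t \<partial>circ) = 1"
    and g: "integrable circ g" "integrable circ (\<lambda>t. N (g t) powr q)"
  shows "(\<integral>t. N (conv K g t) powr q \<partial>circ) \<le> (\<integral>t. N (g t) powr q \<partial>circ)"
proof -
  let ?v = "\<lambda>s. N (g s) powr q"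
  note bK = bpm_trig_poly[OF K(1)]
  note iv = integrable_bpm_scaleR[OF bK g(2), unfolded real_scaleR_def]
  have [measurable]: "?v \<in> borel_measurable circ" "K \<in> borel_measurable borel"
    using g(2) bpm_measurable[OF bK] by auto
  have "?v \<circ> snd \<in> borel_measurable (circ \<Otimes>\<^sub>M circ)"
    by (rule measurable_comp[OF measurable_snd]) simp
  then have [measurable]: "(\<lambda>x. ?v (snd x)) \<in> borel_measurable (circ \<Otimes>\<^sub>M circ)" by (simp add: o_def)
  have v0: "?v s \<ge> 0" for s by simp
  have meas: "(\<lambda>x. K (fst x - snd x) * ?v (snd x)) \<in> borel_measurable (circ \<Otimes>\<^sub>M circ)" by measurable
  have bd: "\<bar>\<integral>s. K (t - s) * ?v s \<partial>circ\<bar> \<le> B * (\<integral>s. ?v s \<partial>circ)" if B: "\<And>t. norm (K t) \<le> B" for B t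
  proof -
    have "norm (\<integral>s. K (t - s) * ?v s \<partial>circ) \<le> (\<integral>s. B * ?v s \<partial>circ)"
      using B g(2) K(2) by (intro Bochner_Integration.integral_norm_bound_integral iv) (auto simp:
          abs_mult intro!: mult_right_mono)
    then show ?thesis by simp
  qed
  obtain B where B: "\<And>t. norm (K t) \<le> B" using bpm_bound[OF bK] by metis
  have int2: "integrable circ (\<lambda>t. \<integral>s. K (t - s) * ?v s \<partial>circ)"
    using meas by (intro integrable_circ_bounded[of _ "B * (\<integral>s. ?v s \<partial>circ)"]
        circ.borel_measurable_lebesgue_integral)
      (auto simp: split_def bd[OF B])
  \<comment> \<open>The power of \<open>N (g s)\<close> may be unbounded, so integrability on the
    product is obtained from the iterated integrals.\<close>
  have "integrable (circ \<Otimes>\<^sub>M circ) (\<lambda>x. K (fst x - snd x) * ?v (snd x))"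
    using int2 iv K(2) by (intro circ2.Fubini_integrable meas) (auto simp: abs_mult)
  then have fub: "(\<integral>t. \<integral>s. K (t - s) * ?v s \<partial>circ \<partial>circ) = (\<integral>s. \<integral>t. K (t - s) * ?v s \<partial>circ \<partial>circ)"
    by (intro circ2.Fubini_integral[symmetric]) (simp add: split_def)
  have "(\<integral>t. N (conv K g t) powr q \<partial>circ) \<le> (\<integral>t. \<integral>s. K (t - s) * ?v s \<partial>circ \<partial>circ)"
  proof (rule integral_mono[OF integrable_bpm[OF bpm_is_norm_powr[OF N bpm_conv[OF K(1) g(1)]]]
      int2])
    fix t
    have "(\<integral>s. K (t - s) \<partial>circ) = 1" using integral_unit_reflect[OF bK] K(3) by simp
    then show "N (conv K g t) powr q \<le> (\<integral>s. K (t - s) * ?v s \<partial>circ)"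
      unfolding conv_def using K(2) integrable_bpm_compose[OF bK, of "\<lambda>s. t - s"]
      by (intro jensen_is_norm N integrable_conv bK g iv) auto
  qed
  also have "\<dots> = (\<integral>s. ?v s \<partial>circ)"
    using integral_unit_shift[OF bK, of "- _"] K(3) by (simp add: fub)
  finally show ?thesis .
qed

section \<open>Density of bounded continuous functions in the integrable ones\<close>

definition truncate :: "real \<Rightarrow> 'a::real_normed_vector \<Rightarrow> 'a" where
  "truncate M y = (1 / max 1 (norm y / M)) *\<^sub>R y"

lemma continuous_on_truncate: "M > 0 \<Longrightarrow> continuous_on UNIV (truncate M)"
  unfolding truncate_def[abs_def] by (intro continuous_intros) (auto simp: max_def)

lemma norm_truncate_le: "M > 0 \<Longrightarrow> norm (truncate M y) \<le> M" "norm (truncate M y) \<le> norm y"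
proof -
  show "norm (truncate M y) \<le> M" if "M > 0" using that
    by (auto simp: truncate_def max_def field_simps)
  have "1 / max 1 (norm y / M) * norm y \<le> 1 * norm y" by (intro mult_right_mono) auto
  then show "norm (truncate M y) \<le> norm y" by (simp add: truncate_def)
qed

lemma truncate_eq: "norm y \<le> M \<Longrightarrow> M > 0 \<Longrightarrow> truncate M y = y"
  by (simp add: truncate_def max_def)

text \<open>First \<open>f\<close> is retracted radially to a large ball, then a sequence of
  continuous functions converging to it almost everywhere is retracted to the same ball. Each stage
  is a case of dominated convergence.\<close>

lemma L1_approx_continuous:
  fixes f :: "real \<Rightarrow> 'a::euclidean_space"
  assumes f: "integrable circ f" and e: "e > 0"
  obtains g where "continuous_on UNIV g" "bounded (range g)" "(\<integral>t. norm (f t - g t) \<partial>circ) < e"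
proof -
  have [measurable]: "truncate (real (Suc M)) \<in> borel_measurable borel" for M
    by (rule borel_measurable_continuous_onI[OF continuous_on_truncate]) simp
  have [measurable]: "f \<in> borel_measurable circ" using f by simp
  have "(\<lambda>M. \<integral>t. norm (f t - truncate (real (Suc M)) (f t)) \<partial>circ) \<longlonglongrightarrow> (\<integral>t. 0 \<partial>circ)"
  proof (rule integral_dominated_convergence[where w = "\<lambda>t. 2 * norm (f t)"])
    show "AE t in circ. (\<lambda>M. norm (f t - truncate (real (Suc M)) (f t))) \<longlonglongrightarrow> 0"
    proof (rule AE_I2, rule tendsto_eventually)
      fix t
      show "\<forall>\<^sub>F M in sequentially. norm (f t - truncate (real (Suc M)) (f t)) = 0"
        using eventually_ge_at_top[of "nat \<lceil>norm (f t)\<rceil>"]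
        by eventually_elim (simp add: truncate_eq nat_ceiling_le_eq)
    qed
    show "AE t in circ. norm (norm (f t - truncate (real (Suc M)) (f t))) \<le> 2 * norm (f t)" for M
    proof (rule AE_I2)
      fix t show "norm (norm (f t - truncate (real (Suc M)) (f t))) \<le> 2 * norm (f t)"
        using norm_triangle_ineq4[of "f t" "truncate (real (Suc M)) (f t)"]
            norm_truncate_le(2)[of "real (Suc M)" "f t"] by simp
    qed
  qed (use f in \<open>auto simp del: of_nat_Suc\<close>)
  then have "\<forall>\<^sub>F M in sequentially. (\<integral>t. norm (f t - truncate (real (Suc M)) (f t)) \<partial>circ) < e / 2"
    using e by (auto dest!: order_tendstoD(2)[where a = "e / 2"])
  then obtain k where k: "(\<integral>t. norm (f t - truncate (real (Suc k)) (f t)) \<partial>circ) < e / 2"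
    unfolding eventually_sequentially by blast
  define T where "T = (truncate (real (Suc k)) :: 'a \<Rightarrow> 'a)"
  have T: "continuous_on UNIV T" "\<And>y. norm (T y) \<le> real (Suc k)"
    unfolding T_def by (rule continuous_on_truncate, simp, rule norm_truncate_le) simp
  have [measurable]: "T \<in> borel_measurable borel" unfolding T_def by measurable
  have "f measurable_on {0..1}" by (simp add: measurable_on_iff_borel_measurable)
  then obtain S h where S: "negligible S" and h: "\<And>n. continuous_on UNIV (h n)"
    and lim: "\<And>x. x \<notin> S \<Longrightarrow> (\<lambda>n. h n x) \<longlonglongrightarrow> (if x \<in> {0..1} then f x else 0)"
    unfolding measurable_on_def by blast
  have Th: "continuous_on UNIV (\<lambda>t. T (h n t))" for n
    by (rule continuous_on_compose2[OF T(1) h]) auto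
  have [measurable]: "h n \<in> borel_measurable borel" for n
    by (rule borel_measurable_continuous_onI[OF h])
  have ae: "AE t in circ. t \<notin> S"
    using S by (auto simp: AE_restrict_space_iff negligible_iff_null_sets intro: AE_not_in AE_I2
        eventually_mono[OF AE_not_in])
  \<comment> \<open>Nothing bounds the functions \<open>h n\<close> themselves; applying
    \<open>T\<close> supplies the constant dominating function.\<close>
  have "(\<lambda>n. \<integral>t. norm (T (f t) - T (h n t)) \<partial>circ) \<longlonglongrightarrow> (\<integral>t. 0 \<partial>circ)"
  proof (rule integral_dominated_convergence[where w = "\<lambda>t. 2 * real (Suc k)"])
    show "AE t in circ. (\<lambda>n. norm (T (f t) - T (h n t))) \<longlonglongrightarrow> 0"
      using ae AE_space
    proof eventually_elim
      case (elim t)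
      then have "(\<lambda>n. T (h n t)) \<longlonglongrightarrow> T (f t)"
        using lim[of t] T(1) by (auto intro!: continuous_on_tendsto_compose[OF T(1)])
      then have "(\<lambda>n. norm (T (f t) - T (h n t))) \<longlonglongrightarrow> norm (T (f t) - T (f t))"
        by (intro tendsto_intros)
      then show ?case by simp
    qed
    show "AE t in circ. norm (norm (T (f t) - T (h n t))) \<le> 2 * real (Suc k)" for n
    proof (rule AE_I2)
      fix t show "norm (norm (T (f t) - T (h n t))) \<le> 2 * real (Suc k)"
        using norm_triangle_ineq4[of "T (f t)" "T (h n t)"] T(2)[of "f t"] T(2)[of "h n t"] by simp
    qed
  qed auto
  then have "\<forall>\<^sub>F n in sequentially. (\<integral>t. norm (T (f t) - T (h n t)) \<partial>circ) < e / 2"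
    using e by (auto dest!: order_tendstoD(2)[where a = "e / 2"])
  then obtain n where n: "(\<integral>t. norm (T (f t) - T (h n t)) \<partial>circ) < e / 2"
    unfolding eventually_sequentially by blast
  have iTf: "integrable circ (\<lambda>t. T (f t))" "integrable circ (\<lambda>t. T (h n t))"
    using T(2) by (auto intro!: integrable_circ_bounded)
  show ?thesis
  proof
    show "continuous_on UNIV (\<lambda>t. T (h n t))" by (rule Th)
    show "bounded (range (\<lambda>t. T (h n t)))" using T(2) by (auto simp: bounded_iff)
    have "(\<integral>t. norm (f t - T (h n t)) \<partial>circ)
        \<le> (\<integral>t. norm (f t - T (f t)) + norm (T (f t) - T (h n t)) \<partial>circ)"
      using f iTf norm_triangle_ineq[of "f t - T (f t)" "T (f t) - T (h n t)" for t]
      by (intro integral_mono) auto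
    also have "\<dots> = (\<integral>t. norm (f t - T (f t)) \<partial>circ) + (\<integral>t. norm (T (f t) - T (h n t)) \<partial>circ)"
      using f iTf by (intro Bochner_Integration.integral_add) auto
    also have "\<dots> < e" using k n by (simp add: T_def)
    finally show "(\<integral>t. norm (f t - T (h n t)) \<partial>circ) < e" .
  qed
qed

text \<open>The de la Vallee-Poussin kernel, which concentrates at the integers as \<open>k\<close> grows.\<close>

definition bump :: "nat \<Rightarrow> real \<Rightarrow> real" where
  "bump k t = ((1 + cos (2 * pi * t)) / 2) ^ k"

definition vp_kernel :: "nat \<Rightarrow> real \<Rightarrow> real" where
  "vp_kernel k t = bump k t / (\<integral>t. bump k t \<partial>circ)"

lemma trig_poly_bump: "trig_poly (bump k)"
proof (induction k)
  case 0 then show ?case using trig_poly.const[of 1] by (simp add: bump_def[abs_def])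
next
  case (Suc k)
  have "trig_poly (\<lambda>t. (1 / 2 + 1 / 2 * cos (2 * pi * t)) * bump k t)"
    by (intro trig_poly.intros Suc)
  then show ?case by (simp add: bump_def[abs_def] add_divide_distrib)
qed

lemma bump_base: "0 \<le> (1 + cos (2 * pi * t)) / (2 :: real)"
proof -
  have "- 1 \<le> cos (2 * pi * t)" by (rule cos_ge_minus_one)
  then have "0 \<le> 1 + cos (2 * pi * t)" by linarith
  then show ?thesis by simp
qed

lemma bump_nonneg: "0 \<le> bump k t"
  unfolding bump_def using bump_base by (intro zero_le_power)

text \<open>On \<open>{0..\<delta>}\<close> the cosine decreases, so the bump is at least its value
  at the right end. The bound gives both positive mass and the decay of the normalized
  tails.\<close>

lemma integral_bump_ge:
  assumes "0 < \<delta>" "\<delta> \<le> 1 / 2"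
  shows "\<delta> * bump k \<delta> \<le> (\<integral>t. bump k t \<partial>circ)"
proof -
  have m: "measure circ {0..\<delta>} = \<delta>" using assms by (simp add: measure_restrict_space)
  have [measurable]: "{0..\<delta>} \<in> sets circ" using assms by (auto simp: sets_restrict_space_iff)
  have "(\<integral>t. indicat_real {0..\<delta>} t * bump k \<delta> \<partial>circ) \<le> (\<integral>t. bump k t \<partial>circ)"
  proof (rule integral_mono)
    show "integrable circ (\<lambda>t. indicat_real {0..\<delta>} t * bump k \<delta>)"
      by (intro integrable_mult_left integrable_circ_bounded[of _ 1]) (auto simp: indicator_def)
    show "integrable circ (bump k)" by (rule integrable_bpm[OF bpm_trig_poly[OF trig_poly_bump]])
    fix t
    show "indicat_real {0..\<delta>} t * bump k \<delta> \<le> bump k t"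
    proof (cases "t \<in> {0..\<delta>}")
      case True
      have "cos (2 * pi * \<delta>) \<le> cos (2 * pi * t)"
        using True assms by (intro cos_monotone_0_pi_le) (auto intro!: mult_left_mono)
      then show ?thesis using True bump_base[of \<delta>] by (auto simp: bump_def intro!: power_mono)
    qed (simp add: bump_nonneg)
  qed
  then show ?thesis using m assms by (simp add: Int_absorb2)
qed

lemma integral_bump_pos: "0 < (\<integral>t. bump k t \<partial>circ)"
proof -
  have "0 < 1 / 4 * bump k (1 / 4)" by (simp add: bump_def)
  then show ?thesis using integral_bump_ge[of "1 / 4" k] by simp
qed

lemma trig_poly_vp_kernel: "trig_poly (vp_kernel k)"
proof -
  have "trig_poly (\<lambda>t. (1 / (\<integral>t. bump k t \<partial>circ)) * bump k t)"
    by (intro trig_poly.intros trig_poly_bump)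
  then show ?thesis by (simp add: vp_kernel_def[abs_def])
qed

lemma vp_kernel_nonneg: "0 \<le> vp_kernel k t"
  using integral_bump_pos[of k] by (simp add: vp_kernel_def bump_nonneg)

lemma integral_vp_kernel: "(\<integral>t. vp_kernel k t \<partial>circ) = 1"
  using integral_bump_pos[of k] by (simp add: vp_kernel_def)

text \<open>Away from the integers the bump is at most \<open>b ^ k\<close>, while its mass is at
  least \<open>\<delta> / 2 * a ^ k\<close> with the larger base \<open>a\<close> taken at
  \<open>\<delta> / 2\<close>; the quotient decays geometrically.\<close>

lemma vp_kernel_tail:
  assumes \<delta>: "0 < \<delta>" "\<delta> \<le> 1 / 2"
  shows "\<exists>\<eta>. \<eta> \<longlonglongrightarrow> 0 \<and> (\<forall>k x. \<delta> \<le> \<bar>x\<bar> \<longrightarrow> \<bar>x\<bar> \<le> 1 - \<delta> \<longrightarrow> vp_kernel k x \<le> \<eta> k)"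
proof -
  define a b where "a = (1 + cos (2 * pi * (\<delta> / 2))) / 2" and "b = (1 + cos (2 * pi * \<delta>)) / 2"
  have "cos (2 * pi * \<delta>) < cos (2 * pi * (\<delta> / 2))"
    using \<delta> by (intro cos_monotone_0_pi) (auto intro!: mult_left_mono)
  then have ab: "0 \<le> b" "b < a" using bump_base[of \<delta>] by (auto simp: a_def b_def)
  let ?\<eta> = "\<lambda>k. (2 / \<delta>) * (b / a) ^ k"
  have "?\<eta> \<longlonglongrightarrow> (2 / \<delta>) * 0"
    using ab by (intro tendsto_mult_left LIMSEQ_power_zero) auto
  moreover have "vp_kernel k x \<le> ?\<eta> k" if x: "\<delta> \<le> \<bar>x\<bar>" "\<bar>x\<bar> \<le> 1 - \<delta>" for k x
  proof -
    have "cos (2 * pi * \<bar>x\<bar>) \<le> cos (2 * pi * \<delta>)"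
    proof (cases "\<bar>x\<bar> \<le> 1 / 2")
      case True then show ?thesis using x \<delta>
        by (intro cos_monotone_0_pi_le) (auto intro!: mult_left_mono)
    next
      \<comment> \<open>Beyond one half the nearest peak is the one at 1, so the argument is
        reflected to \<open>1 - \<bar>x\<bar>\<close>.\<close>
      case False
      have "cos (2 * pi * \<bar>x\<bar>) = cos (2 * pi * (1 - \<bar>x\<bar>))"
        by (simp add: right_diff_distrib cos_diff)
      also have "\<dots> \<le> cos (2 * pi * \<delta>)" using False x \<delta>
        by (intro cos_monotone_0_pi_le) (auto intro!: mult_left_mono)
      finally show ?thesis .
    qed
    moreover have "cos (2 * pi * \<bar>x\<bar>) = cos (2 * pi * x)" by (cases "x \<ge> 0") auto
    ultimately have "bump k x \<le> b ^ k"
      unfolding bump_def b_def using bump_base[of x] by (intro power_mono) auto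
    moreover have "\<delta> / 2 * a ^ k \<le> (\<integral>t. bump k t \<partial>circ)"
      using integral_bump_ge[of "\<delta> / 2" k] \<delta> by (simp add: bump_def a_def)
    ultimately have "vp_kernel k x \<le> b ^ k / (\<delta> / 2 * a ^ k)"
      unfolding vp_kernel_def using ab \<delta> by (intro frac_le) auto
    then show ?thesis by (simp add: power_divide field_simps)
  qed
  ultimately show ?thesis by (intro exI[of _ ?\<eta>]) auto
qed

section \<open>Convergence of the mollified functions\<close>

lemma is_norm_norm: "is_norm norm"
  by (auto simp: is_norm_def norm_triangle_ineq)

text \<open>Continuity handles the points \<open>s\<close> near \<open>t\<close> and the decay of
  the kernel handles the rest. As \<open>g\<close> need not be periodic, only interior points are
  considered.\<close>

lemma conv_vp_kernel_tendsto:
  fixes g :: "real \<Rightarrow> 'a::euclidean_space"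
  assumes g: "continuous_on UNIV g" "\<And>t. norm (g t) \<le> B" and t: "0 < t" "t < 1"
  shows "(\<lambda>k. norm (conv (vp_kernel k) g t - g t)) \<longlonglongrightarrow> 0"
proof (rule tendstoI)
  fix e :: real assume e: "e > 0"
  have [measurable]: "g \<in> borel_measurable borel" by (rule borel_measurable_continuous_onI[OF g(1)])
  have ig: "integrable circ g" by (rule integrable_circ_bounded[OF _ g(2)]) measurable
  have B: "B \<ge> 0" using order_trans[OF norm_ge_zero g(2)] .
  have "isCont g t" using g(1) by (simp add: continuous_on_eq_continuous_at)
  then obtain d where d: "d > 0" "\<And>s. \<bar>s - t\<bar> < d \<Longrightarrow> norm (g s - g t) < e / 2"
    unfolding continuous_at_eps_delta dist_norm real_norm_def using e by (metis half_gt_zero)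
  \<comment> \<open>The bounds by \<open>t\<close> and \<open>1 - t\<close> keep
    \<open>\<bar>t - s\<bar>\<close> at most \<open>1 - \<delta>\<close>, away from the kernel's
    peaks at 1 and -1.\<close>
  define \<delta> where "\<delta> = min (1 / 2) (min d (min t (1 - t)))"
  have \<delta>: "0 < \<delta>" "\<delta> \<le> 1 / 2" "\<delta> \<le> d" "\<delta> \<le> t" "\<delta> \<le> 1 - t" using t d by (auto simp: \<delta>_def min_def)
  obtain \<eta> where \<eta>: "\<eta> \<longlonglongrightarrow> 0" "\<And>k x. \<delta> \<le> \<bar>x\<bar> \<Longrightarrow> \<bar>x\<bar> \<le> 1 - \<delta> \<Longrightarrow> vp_kernel k x \<le> \<eta> k"
    using vp_kernel_tail[OF \<delta>(1,2)] by blast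
  have bd: "norm (conv (vp_kernel k) g t - g t) \<le> e / 2 + 2 * B * \<eta> k" for k
  proof -
    note bK = bpm_trig_poly[OF trig_poly_vp_kernel[of k]]
    note iK = integrable_bpm_compose[OF bK, of "\<lambda>s. t - s"]
    have \<eta>0: "\<eta> k \<ge> 0" using order_trans[OF vp_kernel_nonneg \<eta>(2)[of \<delta> k]] \<delta> by simp
    have K1: "(\<integral>s. vp_kernel k (t - s) \<partial>circ) = 1"
      using integral_unit_reflect[OF bK] integral_vp_kernel by simp
    then have "conv (vp_kernel k) g t - g t
        = (\<integral>s. vp_kernel k (t - s) *\<^sub>R g s - vp_kernel k (t - s) *\<^sub>R g t \<partial>circ)"
      using integrable_conv[OF bK ig] iK by (simp add: conv_def)
    also have "norm \<dots> \<le> (\<integral>s. e / 2 * vp_kernel k (t - s) + 2 * B * \<eta> k \<partial>circ)"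
    proof (rule Bochner_Integration.integral_norm_bound_integral)
      fix s assume "s \<in> space circ"
      then have s: "0 \<le> s" "s \<le> 1" by auto
      have "vp_kernel k (t - s) * norm (g s - g t) \<le> e / 2 * vp_kernel k (t - s) + 2 * B * \<eta> k"
      proof (cases "\<bar>s - t\<bar> < \<delta>")
        case True
        then have "vp_kernel k (t - s) * norm (g s - g t) \<le> vp_kernel k (t - s) * (e / 2)"
          using d(2)[of s] \<delta> vp_kernel_nonneg by (intro mult_left_mono) auto
        moreover have "0 \<le> 2 * B * \<eta> k" using B \<eta>0 by simp
        ultimately show ?thesis by (simp add: algebra_simps)
      next
        case False
        then have "vp_kernel k (t - s) \<le> \<eta> k" using s t \<delta> by (intro \<eta>) auto
        moreover have "norm (g s - g t) \<le> 2 * B"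
          using norm_triangle_ineq4[of "g s" "g t"] g(2)[of s] g(2)[of t] by simp
        ultimately have "vp_kernel k (t - s) * norm (g s - g t) \<le> \<eta> k * (2 * B)"
          using vp_kernel_nonneg \<eta>0 by (intro mult_mono) auto
        moreover have "0 \<le> e / 2 * vp_kernel k (t - s)" using e vp_kernel_nonneg by simp
        ultimately show ?thesis by (simp add: algebra_simps)
      qed
      then show "norm (vp_kernel k (t - s) *\<^sub>R g s - vp_kernel k (t - s) *\<^sub>R g t)
          \<le> e / 2 * vp_kernel k (t - s) + 2 * B * \<eta> k"
        using vp_kernel_nonneg[of k "t - s"] by (simp add: scaleR_diff_right[symmetric])
    qed (use integrable_conv[OF bK ig] iK in auto)
    also have "\<dots> = e / 2 + 2 * B * \<eta> k" using iK K1 by (simp add: measure_restrict_space)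
    finally show ?thesis .
  qed
  have "(\<lambda>k. e / 2 + 2 * B * \<eta> k) \<longlonglongrightarrow> e / 2 + 2 * B * 0" by (intro tendsto_intros \<eta>)
  then have "\<forall>\<^sub>F k in sequentially. e / 2 + 2 * B * \<eta> k < e"
    by (rule order_tendstoD(2)) (use e in simp)
  then show "\<forall>\<^sub>F k in sequentially. dist (norm (conv (vp_kernel k) g t - g t)) 0 < e"
    by eventually_elim (use bd in \<open>auto intro: le_less_trans\<close>)
qed

lemma norm_conv_le:
  fixes g :: "real \<Rightarrow> 'a::euclidean_space"
  assumes g: "g \<in> borel_measurable borel" "\<And>t. norm (g t) \<le> B"
  shows "norm (conv (vp_kernel k) g t) \<le> B"
proof -
  note bK = bpm_trig_poly[OF trig_poly_vp_kernel[of k]]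
  have ig: "integrable circ g" by (rule integrable_circ_bounded[OF _ g(2)]) (use g in measurable)
  have iK: "integrable circ (\<lambda>s. vp_kernel k (t - s))"
    by (rule integrable_bpm_compose[OF bK]) measurable
  have "norm (conv (vp_kernel k) g t) \<le> (\<integral>s. vp_kernel k (t - s) * B \<partial>circ)"
    unfolding conv_def
    using integrable_conv[OF bK ig] iK g(2) vp_kernel_nonneg
    by (intro Bochner_Integration.integral_norm_bound_integral) (auto intro!: mult_left_mono)
  also have "\<dots> = B" using integral_unit_reflect[OF bK, of t] integral_vp_kernel[of k] by simp
  finally show ?thesis .
qed

text \<open>A three-part estimate through a continuous \<open>g\<close>: the kernel contracts the
  distance of \<open>f\<close> to \<open>g\<close>, and for \<open>g\<close> itself pointwise
  convergence is dominated.\<close>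

lemma L1_mollify:
  fixes f :: "real \<Rightarrow> real ^ 'd"
  assumes f: "integrable circ f" and e: "e > 0"
  shows "\<exists>k. (\<integral>t. norm (conv (vp_kernel k) f t - f t) \<partial>circ) < e"
proof -
  obtain g where g: "continuous_on UNIV g" "bounded (range g)" "(\<integral>t. norm (f t - g t) \<partial>circ) < e /
      3"
    using L1_approx_continuous[OF f, of "e / 3"] e by auto
  obtain B where B: "\<And>t. norm (g t) \<le> B" using g(2) by (auto simp: bounded_iff)
  have gm [measurable]: "g \<in> borel_measurable borel"
    by (rule borel_measurable_continuous_onI[OF g(1)])
  have ig: "integrable circ g" by (rule integrable_circ_bounded[OF _ B]) measurable
  have ic: "integrable circ (conv (vp_kernel k) h)" if "integrable circ h" for k
      and h :: "real \<Rightarrow> real ^ 'd"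
    by (rule integrable_bpm[OF bpm_conv[OF trig_poly_vp_kernel that]])
  have "(\<lambda>k. \<integral>t. norm (conv (vp_kernel k) g t - g t) \<partial>circ) \<longlonglongrightarrow> (\<integral>t. 0 \<partial>circ)"
  proof (rule integral_dominated_convergence[where w = "\<lambda>t. 2 * B"])
    \<comment> \<open>The endpoints, where convergence may fail, form a null set.\<close>
    have "AE t in circ. t \<notin> {0, 1}"
      by (rule AE_not_in) (auto simp: null_sets_def sets_restrict_space_iff
          emeasure_restrict_space emeasure_lborel_countable)
    then show "AE t in circ. (\<lambda>k. norm (conv (vp_kernel k) g t - g t)) \<longlonglongrightarrow> 0"
      using AE_space by eventually_elim (auto intro!: conv_vp_kernel_tendsto[OF g(1) B])
    show "AE t in circ. norm (norm (conv (vp_kernel k) g t - g t)) \<le> 2 * B" for k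
    proof (rule AE_I2)
      fix t show "norm (norm (conv (vp_kernel k) g t - g t)) \<le> 2 * B"
        using norm_triangle_ineq4[of "conv (vp_kernel k) g t" "g t"] norm_conv_le[OF gm B,
            of k t] B[of t] by simp
    qed
  qed (use ic[OF ig] ig in auto)
  then have "\<forall>\<^sub>F k in sequentially. (\<integral>t. norm (conv (vp_kernel k) g t - g t) \<partial>circ) < e / 3"
    using e by (auto dest!: order_tendstoD(2)[where a = "e / 3"])
  then obtain k where k: "(\<integral>t. norm (conv (vp_kernel k) g t - g t) \<partial>circ) < e / 3"
    unfolding eventually_sequentially by blast
  let ?K = "vp_kernel k"
  note bK = bpm_trig_poly[OF trig_poly_vp_kernel[of k]]
  have ifg: "integrable circ (\<lambda>t. f t - g t)" using f ig by simp
  have lin: "conv ?K f t - conv ?K g t = conv ?K (\<lambda>t. f t - g t) t" for t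
    using integrable_conv[OF bK f] integrable_conv[OF bK ig]
      by (simp add: conv_def scaleR_diff_right)
  have 1: "(\<integral>t. norm (conv ?K f t - conv ?K g t) \<partial>circ) \<le> (\<integral>t. norm (f t - g t) \<partial>circ)"
    using integral_conv_powr_le[OF is_norm_norm _ trig_poly_vp_kernel[of k]
        vp_kernel_nonneg integral_vp_kernel, of 1 "\<lambda>t. f t - g t"] ifg
    by (simp add: lin)
  note ii = ic[OF f, of k] ic[OF ig, of k] f ig
  have "(\<integral>t. norm (conv ?K f t - f t) \<partial>circ)
      \<le> (\<integral>t. norm (conv ?K f t - conv ?K g t) + (norm (conv ?K g t - g t)
          + norm (f t - g t)) \<partial>circ)"
  proof (rule integral_mono)
    fix t
    show "norm (conv ?K f t - f t)
        \<le> norm (conv ?K f t - conv ?K g t) + (norm (conv ?K g t - g t) + norm (f t - g t))"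
      using norm_triangle_ineq4[of "(conv ?K f t - conv ?K g t) + (conv ?K g t - g t)" "f t - g t"]
        norm_triangle_ineq[of "conv ?K f t - conv ?K g t" "conv ?K g t - g t"] by simp
  qed (use ii in auto)
  also have "\<dots> = (\<integral>t. norm (conv ?K f t - conv ?K g t) \<partial>circ)
      + ((\<integral>t. norm (conv ?K g t - g t) \<partial>circ) + (\<integral>t. norm (f t - g t) \<partial>circ))"
    using ii by simp
  also have "\<dots> < e" using 1 g(3) k by simp
  finally show ?thesis by blast
qed

section \<open>The Hausdorff distance\<close>

lemma curve_dist_triangle:
  assumes N: "is_norm N"
    and m: "f \<in> borel_measurable circ" "g \<in> borel_measurable circ" "h \<in> borel_measurable circ"
  shows "curve_dist N f h \<le> curve_dist N f g + curve_dist N g h"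
proof -
  have "curve_dist N f h \<le> (\<integral>\<^sup>+t. ennreal (N (f t - g t)) + ennreal (N (g t - h t)) \<partial>circ)"
    unfolding curve_dist_def
    using is_norm_nonneg[OF N] is_norm_diff_triangle[OF N]
    by (intro nn_integral_mono) (simp flip: ennreal_plus)
  also have "\<dots> = curve_dist N f g + curve_dist N g h"
    unfolding curve_dist_def using m
    by (intro nn_integral_add measurable_compose[OF is_norm_measurable[OF N]
        measurable_ennreal]) auto
  finally show ?thesis .
qed

lemma sobolev_near_spline1:
  assumes N: "is_norm N" "q \<ge> 1" and n: "n \<ge> 1" and m: "m \<ge> 2" and \<alpha>: "\<And>r. r \<le> m \<Longrightarrow> \<alpha> r > 0"
    and f: "f \<in> sobolev_multiball N m q \<alpha>" and e: "e > 0"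
  shows "\<exists>p\<in>discrete_multiball N m q n \<alpha>.
    curve_dist N (spline1 n p) f \<le> ennreal (9 / 2 * \<alpha> 2 / real n ^ 2) + ennreal e"
proof -
  have fi: "integrable circ f" using f by (simp add: sobolev_multiball_def)
  obtain g where g: "\<And>r. r \<le> m \<Longrightarrow> has_periodic_weak_deriv r f (g r)" "\<And>r. r \<le> m
      \<Longrightarrow> Lq_norm_le N q (g r) (\<alpha> r)"
    using f unfolding sobolev_multiball_def by auto metis
  have gi: "integrable circ (g r)" if "r \<le> m" for r
    using g(1)[OF that] by (simp add: has_periodic_weak_deriv_def)
  obtain C where C: "C > 0" "\<And>x. N x \<le> C * norm x" using is_norm_bound[OF N(1)] by blast
  \<comment> \<open>The tolerance is divided by \<open>C\<close> because the distance is measured in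
    \<open>N\<close>.\<close>
  obtain k where k: "(\<integral>t. norm (conv (vp_kernel k) f t - f t) \<partial>circ) < e / C"
    using L1_mollify[OF fi, of "e / C"] e C by auto
  let ?K = "vp_kernel k"
  \<comment> \<open>Two descriptions of \<open>F r\<close> are combined: as mollified weak
    derivative it inherits the bound on \<open>g r\<close>, and as convolution of \<open>f\<close>
    with a differentiated kernel it is the derivative of its predecessor.\<close>
  define F where "F r = conv ?K (g r)" for r
  have Fr: "F r = conv ((deriv ^^ r) ?K) f" if "r \<le> m" for r
    using conv_weak_deriv[OF trig_poly_vp_kernel g(1)[OF that]] by (auto simp: F_def)
  have F: "bpm (F r)" if "r \<le> m" for r
    unfolding F_def by (rule bpm_conv[OF trig_poly_vp_kernel gi[OF that]])
  have "\<exists>p\<in>discrete_multiball N m q n \<alpha>. curve_dist N (spline1 n p) (F 0)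
      \<le> ennreal (9 / 2 * \<alpha> 2 / real n ^ 2)"
  proof (rule smooth_near_spline1[OF N n m \<alpha> F])
    show "(F r has_vector_derivative F (Suc r) t) (at t)" if "r < m" for r t
      using conv_has_vector_derivative[OF trig_poly_funpow_deriv[OF trig_poly_vp_kernel[of k]] fi,
          of r t] that
      by (simp add: Fr)
    show "(\<integral>t. N (F r t) powr q \<partial>circ) \<le> \<alpha> r powr q" if r: "r \<le> m" for r
    proof -
      have iq: "integrable circ (\<lambda>t. N (g r t) powr q)" using g(2)[OF r]
        by (simp add: Lq_norm_le_def)
      have "(\<integral>t. N (F r t) powr q \<partial>circ) \<le> (\<integral>t. N (g r t) powr q \<partial>circ)"
        unfolding F_def by (rule integral_conv_powr_le[OF N trig_poly_vp_kernel vp_kernel_nonneg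
            integral_vp_kernel gi[OF r] iq])
      also have "\<dots> \<le> \<alpha> r powr q"
        using mult_powr_inverse_le_iff[of 1 "\<integral>t. N (g r t) powr q \<partial>circ" "\<alpha> r" q] g(2)[OF r]
            \<alpha>[OF r] N(2)
        by (simp add: Lq_norm_le_def)
      finally show ?thesis .
    qed
  qed
  then obtain p where p: "p \<in> discrete_multiball N m q n \<alpha>"
    "curve_dist N (spline1 n p) (F 0) \<le> ennreal (9 / 2 * \<alpha> 2 / real n ^ 2)" by blast
  have F0: "F 0 = conv ?K f" using Fr[of 0] by simp
  have iF: "integrable circ (F 0)" using integrable_bpm[OF F[of 0]] by simp
  have "curve_dist N (F 0) f = ennreal (\<integral>t. N (F 0 t - f t) \<partial>circ)"
    by (rule curve_dist_eq_integral[OF N(1) iF fi])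
  also have "(\<integral>t. N (F 0 t - f t) \<partial>circ) \<le> (\<integral>t. C * norm (F 0 t - f t) \<partial>circ)"
    using iF fi C(2) by (intro integral_mono integrable_is_norm[OF N(1)]) auto
  then have "ennreal (\<integral>t. N (F 0 t - f t) \<partial>circ) \<le> ennreal e"
    using k C(1) by (intro ennreal_leI) (simp add: F0 field_simps)
  finally have Ff: "curve_dist N (F 0) f \<le> ennreal e" .
  have pd: "discretized_curve n p" using p by (simp add: discrete_multiball_def)
  have "bpm (spline1 n p)" using bpm_avg[OF bpm_step[OF pd n]] avg_step[OF n] by metis
  then have "curve_dist N (spline1 n p) f \<le> curve_dist N (spline1 n p) (F 0) + curve_dist N (F 0) f"
    using iF fi by (intro curve_dist_triangle[OF N(1)]) (auto dest: integrable_bpm)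
  also have "\<dots> \<le> ennreal (9 / 2 * \<alpha> 2 / real n ^ 2) + ennreal e"
    by (intro add_mono p Ff)
  finally show ?thesis using p(1) by blast
qed

theorem theorem2p3:
  fixes m :: nat and \<alpha> :: "nat \<Rightarrow> real"
  assumes "m \<ge> 2" and "\<And>r. r \<le> m \<Longrightarrow> \<alpha> r > 0"
  shows "\<exists>\<kappa>::real. \<forall>(N :: real ^ 'd \<Rightarrow> real) (q :: real) (n :: nat).
           is_norm N \<longrightarrow> q \<ge> 1 \<longrightarrow> n \<ge> 1 \<longrightarrow>
           hausdorff_dist N (spline_multiball N m q n \<alpha>) (sobolev_multiball N m q \<alpha>)
             \<le> ennreal (\<kappa> / real n ^ 2)"
proof (intro exI allI impI)
  \<comment> \<open>The constant is still schematic here; the final \<open>show\<close> fixes it as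
    \<open>(real (m - 1) + 9 / 2) * \<alpha> 2\<close>, which involves neither \<open>N\<close> nor
    \<open>q\<close> nor \<open>n\<close>.\<close>
  fix N :: "real ^ 'd \<Rightarrow> real" and q :: real and n :: nat
  assume N: "is_norm N" and q: "q \<ge> 1" and n: "n \<ge> 1"
  note * = N q n assms
  have a2: "\<alpha> 2 > 0" using assms by simp
  have "(SUP f\<in>spline_multiball N m q n \<alpha>. INF g\<in>sobolev_multiball N m q \<alpha>. curve_dist N f g)
      \<le> ennreal (real (m - 1) * \<alpha> 2 / real n ^ 2)"
  proof (rule SUP_least)
    fix f assume "f \<in> spline_multiball N m q n \<alpha>"
    then obtain p where "p \<in> discrete_multiball N m q n \<alpha>" and f: "f = spline1 n p"
      unfolding spline_multiball_def by blast
    from spline1_near_sobolev[OF * this(1)]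
    show "(INF g\<in>sobolev_multiball N m q \<alpha>. curve_dist N f g)
        \<le> ennreal (real (m - 1) * \<alpha> 2 / real n ^ 2)"
      unfolding f by (blast intro: INF_lower2)
  qed
  moreover have "(SUP g\<in>sobolev_multiball N m q \<alpha>. INF f\<in>spline_multiball N m q n \<alpha>. curve_dist N
      f g)
      \<le> ennreal (9 / 2 * \<alpha> 2 / real n ^ 2)"
  \<comment> \<open>The arbitrary \<open>e\<close> absorbs the mollification error: the
    approximating spline may change with \<open>e\<close>, but the infimum does not.\<close>
  proof (rule SUP_least, rule ennreal_le_epsilon)
    fix g and e :: real
    assume "g \<in> sobolev_multiball N m q \<alpha>" "0 < e"
    from sobolev_near_spline1[OF * this]
    show "(INF f\<in>spline_multiball N m q n \<alpha>. curve_dist N f g)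
        \<le> ennreal (9 / 2 * \<alpha> 2 / real n ^ 2) + ennreal e"
      unfolding spline_multiball_def by (blast intro: INF_lower2)
  qed
  ultimately have "hausdorff_dist N (spline_multiball N m q n \<alpha>) (sobolev_multiball N m q \<alpha>)
      \<le> ennreal (real (m - 1) * \<alpha> 2 / real n ^ 2) + ennreal (9 / 2 * \<alpha> 2 / real n ^ 2)"
    unfolding hausdorff_dist_def by (rule add_mono)
  also have "\<dots> = ennreal ((real (m - 1) + 9 / 2) * \<alpha> 2 / real n ^ 2)"
    using a2 by (subst ennreal_plus[symmetric]) (auto simp: add_divide_distrib distrib_right)
  finally show "hausdorff_dist N (spline_multiball N m q n \<alpha>) (sobolev_multiball N m q \<alpha>)
      \<le> ennreal ((real (m - 1) + 9 / 2) * \<alpha> 2 / real n ^ 2)" .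
qed

end
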